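(* Let $(\mathcal D_n)_{n\in\mathbb N}$, $\mathcal D_n=(\phi_\omega^n:\omega\in\Omega_n)$, be an asymptotically stable family of frames in $\mathbb R^{I_n}$ with analysis operators $\boldsymbol\Phi_n$, and let $(\alpha_n)_{n\in\mathbb N}$ be a sequence of numbers in $(0,1)$ converging to some $\alpha\in[0,1)$. Consider the data $Y_n=x_n+\boldsymbol\Phi_n\epsilon_n$, where $\epsilon_n$ is a random vector in $\mathbb R^{I_n}$ with independent $N(0,\sigma^2)$-distributed entries. Then, with the extreme value thresholds $$T(\alpha_n,|\Omega_n|):=\sigma\sqrt{2\log|\Omega_n|}+\sigma\,\frac{2z(\alpha_n)-\log\log|\Omega_n|-\log\pi}{2\sqrt{2\log|\Omega_n|}},\qquad z(\alpha_n):=-\log\log\big(1/(1-\alpha_n)\big),$$ and the balls $R(Y_n,T):=\{\bar x_n\in\mathbb R^{\Omega_n}:\|\bar x_n-Y_n\|_\infty\le T\}$, we have $$\lim_{n\to\infty}\mathbf P\big\{x_n\in R\big(Y_n,T(\alpha_n,|\Omega_n|)\big)\,;\ \forall x_n\in\operatorname{Ran}(\boldsymbol\Phi_n)\big\}=1-\alpha.$$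
   Context: Fix $d\in\mathbb N$ and $\sigma>0$; $I_n=\{0,\dots,n-1\}^d$, and $\mathbb R^{I_n}$ carries the Euclidean inner product $\langle\cdot,\cdot\rangle$ and norm $\|\cdot\|$. For each $n$, $\mathcal D_n=(\phi_\omega^n:\omega\in\Omega_n)$, $\Omega_n$ finite, is a frame of $\mathbb R^{I_n}$: there are $0<a_n\le b_n<\infty$ with $a_n\|u\|^2\le\sum_{\omega}|\langle\phi_\omega^n,u\rangle|^2\le b_n\|u\|^2$ for all $u$; the frame bounds $a_n,b_n$ are the largest, respectively smallest, such constants. The analysis operator $\boldsymbol\Phi_n:\mathbb R^{I_n}\to\mathbb R^{\Omega_n}$ is $(\boldsymbol\Phi_nu)(\omega)=\langle\phi_\omega^n,u\rangle$, with range $\operatorname{Ran}(\boldsymbol\Phi_n)$; $\|x\|_\infty=\max_\omega|x(\omega)|$. A family of frames with normalized elements ($\|\phi_\omega^n\|=1$) is asymptotically stable if (i) for some $\rho\in(0,1)$, $|\{(\omega,\omega')\in\Omega_n^2:\omega\ne\omega',\ |\langle\phi_\omega^n,\phi_{\omega'}^n\rangle|\ge\rho\}|=o\big(|\Omega_n|/\sqrt{\log|\Omega_n|}\big)$ as $n\to\infty$; and (ii) $\sup_n b_n<\infty$. The notation $\mathbf P\{A(x_n);\forall x_n\in S\}$ means the probability of the intersection of the events $A(x_n)$ over all $x_n\in S$, the noise $\epsilon_n$ being the same for all $x_n$. *)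

theory Defs
  imports "HOL-Probability.Probability" "HOL-Library.Landau_Symbols"
begin

text \<open>
  For a finite index set \<open>A\<close>, the space of real vectors indexed by \<open>A\<close> is represented by the set
  \<^term>\<open>extensional A\<close> of functions that are undefined outside \<open>A\<close>; its Euclidean norm is
  \<^term>\<open>\<lambda>u. L2_set u A\<close>.
\<close>

definition grid :: "nat \<Rightarrow> nat \<Rightarrow> (nat \<Rightarrow> nat) set" where
  "grid d n = {..<d} \<rightarrow>\<^sub>E {..<n}"

definition inner_on :: "'i set \<Rightarrow> ('i \<Rightarrow> real) \<Rightarrow> ('i \<Rightarrow> real) \<Rightarrow> real" where
  "inner_on A u v = (\<Sum>i\<in>A. u i * v i)"

definition sup_norm_on :: "'i set \<Rightarrow> ('i \<Rightarrow> real) \<Rightarrow> real" where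
  "sup_norm_on A x = Max ((\<lambda>i. \<bar>x i\<bar>) ` A)"

definition frame_constants ::
    "'i set \<Rightarrow> 'w set \<Rightarrow> ('w \<Rightarrow> 'i \<Rightarrow> real) \<Rightarrow> real \<Rightarrow> real \<Rightarrow> bool" where
  "frame_constants I \<Omega> \<phi> a b \<longleftrightarrow> 0 < a \<and> a \<le> b \<and>
     (\<forall>u\<in>extensional I.
        a * (L2_set u I)\<^sup>2 \<le> (\<Sum>\<omega>\<in>\<Omega>. \<bar>inner_on I (\<phi> \<omega>) u\<bar>\<^sup>2) \<and>
        (\<Sum>\<omega>\<in>\<Omega>. \<bar>inner_on I (\<phi> \<omega>) u\<bar>\<^sup>2) \<le> b * (L2_set u I)\<^sup>2)"

definition is_frame :: "'i set \<Rightarrow> 'w set \<Rightarrow> ('w \<Rightarrow> 'i \<Rightarrow> real) \<Rightarrow> bool" where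
  "is_frame I \<Omega> \<phi> \<longleftrightarrow>
     finite \<Omega> \<and> \<phi> \<in> \<Omega> \<rightarrow> extensional I \<and> (\<exists>a b. frame_constants I \<Omega> \<phi> a b)"

definition upper_frame_bound :: "'i set \<Rightarrow> 'w set \<Rightarrow> ('w \<Rightarrow> 'i \<Rightarrow> real) \<Rightarrow> real" where
  "upper_frame_bound I \<Omega> \<phi> = (LEAST b. \<exists>a. frame_constants I \<Omega> \<phi> a b)"

definition analysis_op ::
    "'i set \<Rightarrow> 'w set \<Rightarrow> ('w \<Rightarrow> 'i \<Rightarrow> real) \<Rightarrow> ('i \<Rightarrow> real) \<Rightarrow> 'w \<Rightarrow> real" where
  "analysis_op I \<Omega> \<phi> u = (\<lambda>\<omega>\<in>\<Omega>. inner_on I (\<phi> \<omega>) u)"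

definition analysis_range :: "'i set \<Rightarrow> 'w set \<Rightarrow> ('w \<Rightarrow> 'i \<Rightarrow> real) \<Rightarrow> ('w \<Rightarrow> real) set" where
  "analysis_range I \<Omega> \<phi> = analysis_op I \<Omega> \<phi> ` extensional I"

text \<open>
  The families are indexed by the positive integers; the values at \<open>n = 0\<close>, where the grid
  is empty (for positive \<open>d\<close>), are unconstrained.
\<close>

definition asymptotically_stable ::
    "nat \<Rightarrow> (nat \<Rightarrow> 'w set) \<Rightarrow> (nat \<Rightarrow> 'w \<Rightarrow> (nat \<Rightarrow> nat) \<Rightarrow> real) \<Rightarrow> bool" where
  "asymptotically_stable d \<Omega> \<phi> \<longleftrightarrow>
     (\<forall>n\<ge>1. is_frame (grid d n) (\<Omega> n) (\<phi> n)) \<and>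
     (\<forall>n\<ge>1. \<forall>\<omega>\<in>\<Omega> n. L2_set (\<phi> n \<omega>) (grid d n) = 1) \<and>
     (\<exists>\<rho>. 0 < \<rho> \<and> \<rho> < 1 \<and>
        (\<lambda>n. real (card {(\<omega>, \<omega>'). \<omega> \<in> \<Omega> n \<and> \<omega>' \<in> \<Omega> n \<and> \<omega> \<noteq> \<omega>' \<and>
                            \<bar>inner_on (grid d n) (\<phi> n \<omega>) (\<phi> n \<omega>')\<bar> \<ge> \<rho>}))
          \<in> o(\<lambda>n. real (card (\<Omega> n)) / sqrt (ln (real (card (\<Omega> n)))))) \<and>
     bdd_above ((\<lambda>n. upper_frame_bound (grid d n) (\<Omega> n) (\<phi> n)) ` {1..})"

definition gumbel_quantile :: "real \<Rightarrow> real" where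
  "gumbel_quantile \<alpha> = - ln (ln (1 / (1 - \<alpha>)))"

definition ev_threshold :: "real \<Rightarrow> real \<Rightarrow> nat \<Rightarrow> real" where
  "ev_threshold \<sigma> \<alpha> m =
     \<sigma> * sqrt (2 * ln (real m)) +
     \<sigma> * ((2 * gumbel_quantile \<alpha> - ln (ln (real m)) - ln pi) / (2 * sqrt (2 * ln (real m))))"

definition sup_ball :: "'w set \<Rightarrow> ('w \<Rightarrow> real) \<Rightarrow> real \<Rightarrow> ('w \<Rightarrow> real) set" where
  "sup_ball \<Omega> y T = {x \<in> extensional \<Omega>. sup_norm_on \<Omega> (\<lambda>\<omega>. x \<omega> - y \<omega>) \<le> T}"

end

theory Submission
  imports Defs
begin

text \<open>
  The event says that the maximum of the Gaussian coefficients
  \<open>\<bar>\<langle>\<phi>\<^sub>\<omega>, \<epsilon>\<rangle>\<bar>\<close> is at most \<open>T\<close>, whatever \<open>x\<close> is; for independent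
  coefficients the limit is the classical Gumbel limit, so it suffices to decouple them. Elements
  occurring in a pair with correlation at least \<open>\<rho>\<close> are discarded: there are
  \<open>o(m / \<surd>(log m))\<close> of them, where \<open>m = |\<Omega>\<^sub>n|\<close>, and each exceeds \<open>T\<close> with
  probability \<open>O(\<surd>(log m) / m)\<close>. For the other ones, indicators are replaced by a smooth cutoff
  \<open>g\<close> that descends from 1 to 0 as \<open>x\<^sup>2\<close> runs from \<open>T\<^sup>2\<close> to \<open>T\<^sup>2 + \<delta>\<close>, which shifts the
  Gumbel quantile by only \<open>\<delta>/2\<close>. Rotating the coefficients into independent ones and
  integrating by parts, the derivative of the expectation of \<open>\<Prod> g\<close> is a sum over pairs of
  \<open>\<kappa>\<close> times a mixed second derivative supported where both coefficients exceed \<open>T\<close>; it is therefore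
  bounded by a multiple of \<open>T\<^sup>2 \<Sum> \<bar>\<kappa>\<bar> exp (- T\<^sup>2 / (1 + \<bar>\<kappa>\<bar>))\<close>. This tends to 0 because
  \<open>\<bar>\<kappa>\<bar> < \<rho> < 1\<close> and because the upper frame bounds give \<open>\<Sum> \<kappa>\<^sup>2 = O(m)\<close>.
\<close>

section \<open>Standard Gaussian measures\<close>

text \<open>A frame may be redundant, so its coefficients can have a singular covariance and no
  joint density. Hence the interpolation rotates linear forms on one product measure, instead of
  differentiating a Gaussian density in its covariance entries. The cutoff lives in x^2 because T^2
  = 2 log m - log log m - log pi + 2 z + o(1) is affine in z: a window of fixed width \<delta> costs
  a fixed shift of z, and the slope of \<open>g\<close> is of order T / \<delta>, whose square is
  the factor T^2. The limit in n is taken at fixed \<delta>; only then \<delta> tends to 0, by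
  continuity of the Gumbel distribution function. Since T^2 is about 2 log m, a pair contributes
  roughly m^(-2 / (1 + |\<kappa>|)). Large correlations are few because \<Sum> \<kappa>^2 = O(m),
  and for small ones the exponent is close to -2. The lower frame bounds give m \<ge> n^d, so that m
  tends to infinity. Varying \<alpha>_n, also with limit 0, where z diverges, are handled by
  monotonicity in the level.\<close>

abbreviation std_normal :: "real measure" where
  "std_normal \<equiv> density lborel std_normal_density"

definition gauss :: "'k set \<Rightarrow> ('k \<Rightarrow> real) measure" where
  "gauss K = (\<Pi>\<^sub>M k\<in>K. std_normal)"

lemma sets_gauss [measurable_cong]: "sets (gauss K) = sets (\<Pi>\<^sub>M k\<in>K. borel)"
  unfolding gauss_def by (intro sets_PiM_cong) auto

interpretation std_normal: prob_space std_normal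
  by (rule prob_space_normal_density) simp

interpretation gauss_prod: product_prob_space "\<lambda>_. std_normal" K for K
  by unfold_locales

lemma prob_space_gauss: "prob_space (gauss K)"
  unfolding gauss_def by (rule gauss_prod.prob_space_axioms)

lemma integral_std_normal:
  fixes f :: "real \<Rightarrow> real"
  assumes [measurable]: "f \<in> borel_measurable borel"
  shows "(\<integral>x. f x \<partial>std_normal) = (\<integral>x. std_normal_density x * f x \<partial>lborel)"
  by (subst integral_real_density) auto

lemma integrable_std_normal:
  fixes f :: "real \<Rightarrow> real"
  assumes [measurable]: "f \<in> borel_measurable borel"
  shows "integrable std_normal f \<longleftrightarrow> integrable lborel (\<lambda>x. std_normal_density x * f x)"
  by (subst integrable_real_density) auto

lemma integrable_id_std_normal: "integrable std_normal (\<lambda>x. x)"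
  using integrable_std_normal_moment[of 1] by (subst integrable_std_normal) auto

lemma integrable_component_gauss:
  assumes "k \<in> K"
  shows "integrable (gauss K) (\<lambda>\<xi>. \<xi> k)"
proof -
  have "integrable (distr (gauss K) std_normal (\<lambda>\<xi>. \<xi> k)) (\<lambda>x. x)"
    unfolding gauss_def gauss_prod.PiM_component[OF assms] by (rule integrable_id_std_normal)
  then show ?thesis
    by (rule integrable_distr[rotated]) (use assms in \<open>auto simp: gauss_def\<close>)
qed

section \<open>Gaussian integration by parts\<close>

lemma std_normal_density_tendsto:
  "(std_normal_density \<longlongrightarrow> 0) at_top" "(std_normal_density \<longlongrightarrow> 0) at_bot"
  unfolding std_normal_density_def by real_asymp+

lemma has_field_derivative_std_normal_density [derivative_intros]:
  "(f has_field_derivative f') (at x within S) \<Longrightarrow>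
   ((\<lambda>x. std_normal_density (f x)) has_field_derivative (- f x * std_normal_density (f x) * f')) (at x within S)"
proof -
  assume f: "(f has_field_derivative f') (at x within S)"
  have "((\<lambda>x. c * exp (- (f x)\<^sup>2 / 2)) has_field_derivative (- f x * (c * exp (- (f x)\<^sup>2 / 2)) * f')) (at x within S)" for c
    by (auto intro!: derivative_eq_intros f)
  from this[of "1 / sqrt (2 * pi)"] show ?thesis
    by (simp add: std_normal_density_def)
qed

lemma isCont_std_normal_density [continuous_intros]: "isCont std_normal_density x"
  using has_field_derivative_std_normal_density[OF DERIV_ident] by (rule DERIV_isCont)

text \<open>\<open>f\<close> is the derivative of \<open>g\<close> times the density, and this
  product vanishes at both ends because \<open>g\<close> is bounded; hence \<open>f\<close>
  integrates to 0.\<close>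

lemma stein_std_normal:
  fixes g g' :: "real \<Rightarrow> real"
  assumes g: "\<And>x. (g has_real_derivative g' x) (at x)" and g': "\<And>x. isCont g' x"
    and B: "\<And>x. \<bar>g x\<bar> \<le> B" and B': "\<And>x. \<bar>g' x\<bar> \<le> B'"
  shows "(\<integral>x. x * g x \<partial>std_normal) = (\<integral>x. g' x \<partial>std_normal)"
proof -
  have cont: "isCont g x" for x using g DERIV_isCont by blast
  have [measurable]: "g \<in> borel_measurable borel" "g' \<in> borel_measurable borel"
    using cont g' by (auto intro!: borel_measurable_continuous_onI continuous_at_imp_continuous_on)
  have B0: "B \<ge> 0" using order_trans[OF abs_ge_zero B] .
  define f where "f x = g' x * std_normal_density x - x * g x * std_normal_density x" for x
  have i1: "integrable lborel (\<lambda>x. std_normal_density x * (x * g x))"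
    by (rule Bochner_Integration.integrable_bound[OF integrable_mult_right[OF integrable_std_normal_moment_abs[of 1], of B]])
      (use mult_left_mono[OF B, of "std_normal_density x * \<bar>x\<bar>" for x] B0 in \<open>auto simp: abs_mult mult_ac intro!: AE_I2\<close>)
  have i2: "integrable lborel (\<lambda>x. std_normal_density x * g' x)"
    by (rule Bochner_Integration.integrable_bound[OF integrable_mult_right[OF integrable_normal_density[of 1 0], of B']])
      (use B' in \<open>auto simp: abs_mult mult.commute intro!: mult_right_mono AE_I2 order_trans[OF B' abs_ge_self]\<close>)
  have "(LBINT x=-\<infinity>..\<infinity>. f x) = 0 - 0"
  proof (rule interval_integral_FTC_integrable[where F = "\<lambda>x. g x * std_normal_density x"])
    show "((\<lambda>x. g x * std_normal_density x) has_vector_derivative f x) (at x)" for x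
      unfolding f_def has_real_derivative_iff_has_vector_derivative[symmetric]
      by (auto intro!: derivative_eq_intros g)
    show "isCont f x" for x
      unfolding f_def by (intro continuous_intros cont g' isCont_std_normal_density)
    show "set_integrable lborel (einterval (- \<infinity>) \<infinity>) f"
      using Bochner_Integration.integrable_diff[OF i2 i1]
      by (simp add: f_def[abs_def] set_integrable_def mult_ac)
    have lim: "((\<lambda>x. g x * std_normal_density x) \<longlongrightarrow> 0) F" if "(std_normal_density \<longlongrightarrow> 0) F" for F
    proof (rule Lim_null_comparison)
      show "\<forall>\<^sub>F x in F. norm (g x * std_normal_density x) \<le> B * std_normal_density x"
        using B by (auto simp: abs_mult intro!: mult_right_mono always_eventually)
      show "((\<lambda>x. B * std_normal_density x) \<longlongrightarrow> 0) F"
        using tendsto_mult_right_zero[OF that] by simp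
    qed
    show "(((\<lambda>x. g x * std_normal_density x) \<circ> real_of_ereal) \<longlongrightarrow> 0) (at_right (- \<infinity>))"
      "(((\<lambda>x. g x * std_normal_density x) \<circ> real_of_ereal) \<longlongrightarrow> 0) (at_left \<infinity>)"
      unfolding ereal_tendsto_simps by (intro lim std_normal_density_tendsto)+
  qed simp
  then have "(\<integral>x. f x \<partial>lborel) = 0"
    by (simp add: interval_integral_to_infinity_eq interval_lebesgue_integral_def set_lebesgue_integral_def)
  moreover have "(\<integral>x. f x \<partial>lborel) = (\<integral>x. std_normal_density x * g' x \<partial>lborel) - (\<integral>x. std_normal_density x * (x * g x) \<partial>lborel)"
    unfolding f_def by (subst Bochner_Integration.integral_diff[symmetric, OF i2 i1]) (simp add: mult_ac)
  ultimately show ?thesis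
    by (simp add: integral_std_normal)
qed

text \<open>By Fubini, coordinate \<open>k\<close> is integrated innermost with the others frozen,
  and there the one-dimensional identity applies. This is why derivative and continuity are asked
  for along \<open>\<xi>(k := y)\<close>.\<close>

lemma stein_gauss:
  fixes F F' :: "('k \<Rightarrow> real) \<Rightarrow> real"
  assumes K: "finite K" "k \<in> K"
    and [measurable]: "F \<in> borel_measurable (gauss K)" "F' \<in> borel_measurable (gauss K)"
    and der: "\<And>\<xi> y. ((\<lambda>y. F (\<xi>(k := y))) has_real_derivative F' (\<xi>(k := y))) (at y)"
    and cont: "\<And>\<xi> y. isCont (\<lambda>y. F' (\<xi>(k := y))) y"
    and B: "\<And>\<xi>. \<bar>F \<xi>\<bar> \<le> B" and B': "\<And>\<xi>. \<bar>F' \<xi>\<bar> \<le> B'"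
  shows "(\<integral>\<xi>. \<xi> k * F \<xi> \<partial>gauss K) = (\<integral>\<xi>. F' \<xi> \<partial>gauss K)"
proof -
  interpret G: prob_space "gauss K" by (rule prob_space_gauss)
  have B0: "B \<ge> 0" using order_trans[OF abs_ge_zero B] .
  define J where "J = K - {k}"
  have KJ: "K = insert k J" "finite J" "k \<notin> J" using K by (auto simp: J_def)
  have [measurable]: "(\<lambda>\<xi>. \<xi> k) \<in> borel_measurable (gauss K)"
    using integrable_component_gauss[OF K(2)] by (rule borel_measurable_integrable)
  have i1: "integrable (gauss K) (\<lambda>\<xi>. \<xi> k * F \<xi>)"
    by (rule Bochner_Integration.integrable_bound[OF integrable_mult_right[OF integrable_abs[OF integrable_component_gauss[OF K(2)]], of B]])
      (use B B0 in \<open>auto simp: abs_mult mult.commute[of _ "\<bar>_ k\<bar>"] intro!: mult_left_mono AE_I2\<close>)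
  have i2: "integrable (gauss K) F'"
    by (rule G.integrable_const_bound[where B=B']) (use B' in auto)
  have "(\<integral>\<xi>. \<xi> k * F \<xi> \<partial>gauss K) = (\<integral>\<xi>. (\<integral>y. y * F (\<xi>(k:=y)) \<partial>std_normal) \<partial>PiM J (\<lambda>_. std_normal))"
    using gauss_prod.product_integral_insert[OF KJ(2,3) i1[unfolded gauss_def KJ(1)]]
    by (simp add: gauss_def KJ(1))
  also have "\<dots> = (\<integral>\<xi>. (\<integral>y. F' (\<xi>(k:=y)) \<partial>std_normal) \<partial>PiM J (\<lambda>_. std_normal))"
    by (intro Bochner_Integration.integral_cong refl stein_std_normal[where B=B and B'=B'] der cont B B')
  also have "\<dots> = (\<integral>\<xi>. F' \<xi> \<partial>gauss K)"
    using gauss_prod.product_integral_insert[OF KJ(2,3) i2[unfolded gauss_def KJ(1)]]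
    by (simp add: gauss_def KJ(1))
  finally show ?thesis .
qed

section \<open>Exponential moments and tails of linear forms\<close>

lemma inner_on_add_left: "inner_on K (\<lambda>k. u k + v k) w = inner_on K u w + inner_on K v w"
  by (simp add: inner_on_def algebra_simps sum.distrib)

lemma inner_on_diff_left: "inner_on K (\<lambda>k. u k - v k) w = inner_on K u w - inner_on K v w"
  by (simp add: inner_on_def algebra_simps sum_subtractf)

lemma inner_on_scale_left: "inner_on K (\<lambda>k. r * u k) w = r * inner_on K u w"
  by (simp add: inner_on_def algebra_simps sum_distrib_left)

lemma inner_on_commute: "inner_on K u v = inner_on K v u"
  by (simp add: inner_on_def mult.commute)

lemma inner_on_add_right: "inner_on K w (\<lambda>k. u k + v k) = inner_on K w u + inner_on K w v"
  by (simp add: inner_on_def algebra_simps sum.distrib)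

lemma inner_on_scale_right: "inner_on K w (\<lambda>k. r * u k) = r * inner_on K w u"
  by (simp add: inner_on_def algebra_simps sum_distrib_left)

lemmas inner_on_linear =
  inner_on_add_left inner_on_diff_left inner_on_scale_left inner_on_add_right inner_on_scale_right

lemma measurable_inner_on [measurable]: "inner_on K b \<in> borel_measurable (gauss K)"
  unfolding inner_on_def[abs_def] gauss_def by measurable

lemma integrable_inner_on: "integrable (gauss K) (inner_on K b)"
  unfolding inner_on_def[abs_def]
  by (intro Bochner_Integration.integrable_sum integrable_mult_right integrable_component_gauss)

text \<open>Completing the square turns the integrand into a multiple of the density of N(c,
  1).\<close>

lemma exp_moment_std_normal:
  "has_bochner_integral std_normal (\<lambda>x. exp (c * x)) (exp (c\<^sup>2 / 2))"
proof -
  have eq: "std_normal_density x * exp (c * x) = exp (c\<^sup>2 / 2) * normal_density c 1 x" for x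
  proof -
    have "- x\<^sup>2 / 2 + c * x = c\<^sup>2 / 2 + - (x - c)\<^sup>2 / 2"
      by (simp add: power2_eq_square field_simps)
    then show ?thesis
      by (simp add: normal_density_def mult_exp_exp mult.left_commute)
  qed
  show ?thesis
    by (simp add: has_bochner_integral_iff integrable_std_normal integral_std_normal eq)
qed

lemma exp_moment_gauss:
  assumes "finite K"
  shows "has_bochner_integral (gauss K) (\<lambda>\<xi>. exp (inner_on K c \<xi>)) (exp (inner_on K c c / 2))"
proof -
  note m = exp_moment_std_normal[unfolded has_bochner_integral_iff]
  have eq: "exp (inner_on K c \<xi>) = (\<Prod>k\<in>K. exp (c k * \<xi> k))" for \<xi>
    unfolding inner_on_def using assms by (rule exp_sum)
  have eq2: "exp (inner_on K c c / 2) = (\<Prod>k\<in>K. exp ((c k)\<^sup>2 / 2))"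
    unfolding inner_on_def sum_divide_distrib power2_eq_square using assms by (rule exp_sum)
  have "integrable (gauss K) (\<lambda>\<xi>. \<Prod>k\<in>K. exp (c k * \<xi> k))"
    unfolding gauss_def using m by (intro gauss_prod.product_integrable_prod assms) auto
  moreover have "(\<integral>\<xi>. (\<Prod>k\<in>K. exp (c k * \<xi> k)) \<partial>gauss K) = (\<Prod>k\<in>K. exp ((c k)\<^sup>2 / 2))"
    unfolding gauss_def using m by (subst gauss_prod.product_integral_prod[OF assms]) auto
  ultimately show ?thesis
    unfolding eq eq2 by (simp add: has_bochner_integral_iff)
qed

text \<open>Chernoff bound: Markov's inequality for the exponential moment. Allowing
  \<open>V\<close> to exceed the variance covers degenerate forms as well.\<close>

lemma gauss_tail:
  assumes K: "finite K" and V: "inner_on K c c \<le> V" "0 < V" and t: "0 \<le> t"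
  shows "measure (gauss K) {\<xi>\<in>space (gauss K). t \<le> inner_on K c \<xi>} \<le> exp (- t\<^sup>2 / (2 * V))"
proof -
  interpret G: prob_space "gauss K" by (rule prob_space_gauss)
  \<comment> \<open>The minimiser of l^2 V / 2 - l t.\<close>
  define l where "l = t / V"
  have l: "l \<ge> 0" using t V by (simp add: l_def)
  note m = exp_moment_gauss[OF K, of "\<lambda>k. l * c k", unfolded has_bochner_integral_iff inner_on_linear]
  have "measure (gauss K) {\<xi>\<in>space (gauss K). t \<le> inner_on K c \<xi>}
      \<le> measure (gauss K) {\<xi>\<in>space (gauss K). exp (l * t) \<le> exp (l * inner_on K c \<xi>)}"
    using l by (intro G.finite_measure_mono) (auto intro: mult_left_mono)
  also have "\<dots> \<le> exp (l * (l * inner_on K c c) / 2) / exp (l * t)"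
    using integral_Markov_inequality_measure[OF conjunct1[OF m], of "{}" "exp (l * t)"] m by simp
  also have "\<dots> = exp (l\<^sup>2 * inner_on K c c / 2 - l * t)"
    by (simp add: exp_diff power2_eq_square mult.assoc)
  also have "\<dots> \<le> exp (l\<^sup>2 * V / 2 - l * t)"
    using V by (simp add: mult_left_mono)
  also have "l\<^sup>2 * V / 2 - l * t = - t\<^sup>2 / (2 * V)"
    using V by (simp add: l_def power2_eq_square field_simps)
  finally show ?thesis .
qed

lemma gauss_abs_tail:
  assumes K: "finite K" and a: "inner_on K a a = 1" and t: "0 \<le> t"
  shows "measure (gauss K) {\<xi>\<in>space (gauss K). t \<le> \<bar>inner_on K a \<xi>\<bar>} \<le> 2 * exp (- t\<^sup>2 / 2)"
proof -
  interpret G: prob_space "gauss K" by (rule prob_space_gauss)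
  define E where "E s = {\<xi>\<in>space (gauss K). t \<le> inner_on K (\<lambda>k. s * a k) \<xi>}" for s
  have [measurable]: "E s \<in> sets (gauss K)" for s unfolding E_def by measurable
  have E: "measure (gauss K) (E s) \<le> exp (- t\<^sup>2 / (2 * 1))" if "\<bar>s\<bar> = 1" for s
    unfolding E_def using that abs_mult_self_eq[of s]
    by (intro gauss_tail K t) (simp_all add: inner_on_linear a)
  have "measure (gauss K) {\<xi>\<in>space (gauss K). t \<le> \<bar>inner_on K a \<xi>\<bar>} \<le> measure (gauss K) (E 1 \<union> E (-1))"
    by (intro G.finite_measure_mono) (auto simp: E_def inner_on_def abs_if sum_negf split: if_splits)
  also have "\<dots> \<le> measure (gauss K) (E 1) + measure (gauss K) (E (-1))"
    by (intro measure_Un_le) auto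
  finally show ?thesis using E[of 1] E[of "-1"] by simp
qed

text \<open>If both forms are at least t in modulus, then for some signs p, q the form p X + q Y is
  at least 2 t. Its variance is at most 2 + 2 r, and the Chernoff exponent (2 t)^2 / (2 (2 + 2 r))
  is t^2 / (1 + r). The factor 4 counts the sign choices.\<close>

lemma gauss_joint_tail:
  assumes K: "finite K" and a: "inner_on K a a = 1" and b: "inner_on K b b = 1"
    and r: "\<bar>inner_on K a b\<bar> \<le> r" and t: "0 \<le> t"
  shows "measure (gauss K) {\<xi>\<in>space (gauss K). t \<le> \<bar>inner_on K a \<xi>\<bar> \<and> t \<le> \<bar>inner_on K b \<xi>\<bar>}
      \<le> 4 * exp (- t\<^sup>2 / (1 + r))"
proof -
  interpret G: prob_space "gauss K" by (rule prob_space_gauss)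
  define E where "E p q = {\<xi>\<in>space (gauss K). 2 * t \<le> inner_on K (\<lambda>k. p * a k + q * b k) \<xi>}" for p q
  have [measurable]: "E p q \<in> sets (gauss K)" for p q unfolding E_def by measurable
  have r0: "r \<ge> 0" using r by linarith
  have E: "measure (gauss K) (E p q) \<le> exp (- t\<^sup>2 / (1 + r))" if pq: "\<bar>p\<bar> = 1" "\<bar>q\<bar> = 1" for p q
  proof -
    have "p * p = 1" "q * q = 1" using pq abs_mult_self_eq[of p] abs_mult_self_eq[of q] by auto
    then have "inner_on K (\<lambda>k. p * a k + q * b k) (\<lambda>k. p * a k + q * b k) = 2 + 2 * (p * q * inner_on K a b)"
      by (simp add: inner_on_linear a b algebra_simps inner_on_commute[of K b a])
    also have "p * q * inner_on K a b \<le> r"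
      using r abs_ge_self[of "p * q * inner_on K a b"] pq by (simp add: abs_mult)
    finally have "measure (gauss K) (E p q) \<le> exp (- (2 * t)\<^sup>2 / (2 * (2 + 2 * r)))"
      unfolding E_def using t r0 by (intro gauss_tail K) auto
    also have "- (2 * t)\<^sup>2 / (2 * (2 + 2 * r)) = - t\<^sup>2 / (1 + r)"
      using r0 by (simp add: divide_simps)
    finally show ?thesis .
  qed
  have "measure (gauss K) {\<xi>\<in>space (gauss K). t \<le> \<bar>inner_on K a \<xi>\<bar> \<and> t \<le> \<bar>inner_on K b \<xi>\<bar>}
      \<le> measure (gauss K) ((E 1 1 \<union> E 1 (-1)) \<union> (E (-1) 1 \<union> E (-1) (-1)))"
    by (intro G.finite_measure_mono) (auto simp: E_def inner_on_linear inner_on_def sum_negf abs_if sum_subtractf split: if_splits)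
  also have "\<dots> \<le> (measure (gauss K) (E 1 1) + measure (gauss K) (E 1 (-1)))
      + (measure (gauss K) (E (-1) 1) + measure (gauss K) (E (-1) (-1)))"
    by (intro order_trans[OF measure_Un_le] add_mono measure_Un_le) auto
  also have "\<dots> \<le> 4 * exp (- t\<^sup>2 / (1 + r))"
    using E[of 1 1] E[of 1 "-1"] E[of "-1" 1] E[of "-1" "-1"] by simp
  finally show ?thesis .
qed

text \<open>Dominated convergence for difference quotients: by the mean value theorem a bound on
  \<open>f'\<close> that is uniform in t also bounds every quotient.\<close>

lemma has_real_derivative_integral:
  fixes f f' :: "real \<Rightarrow> 'a \<Rightarrow> real"
  assumes int: "\<And>t. integrable M (f t)" and [measurable]: "\<And>t. f' t \<in> borel_measurable M"
    and der: "\<And>t x. x \<in> space M \<Longrightarrow> ((\<lambda>t. f t x) has_real_derivative f' t x) (at t)"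
    and w: "integrable M w" "\<And>t x. x \<in> space M \<Longrightarrow> \<bar>f' t x\<bar> \<le> w x"
  shows "((\<lambda>t. \<integral>x. f t x \<partial>M) has_real_derivative (\<integral>x. f' t x \<partial>M)) (at t)"
  unfolding has_field_derivative_iff
proof (subst tendsto_at_iff_sequentially, intro allI impI)
  fix X :: "nat \<Rightarrow> real"
  assume X: "\<forall>i. X i \<in> UNIV - {t}" and lim: "X \<longlonglongrightarrow> t"
  have [measurable]: "f s \<in> borel_measurable M" for s
    using int by (rule borel_measurable_integrable)
  have lip: "\<bar>f s x - f t x\<bar> \<le> w x * \<bar>s - t\<bar>" if "x \<in> space M" for s x
    using field_differentiable_bound[of UNIV "\<lambda>t. f t x" "\<lambda>t. f' t x" "w x" s t] der w(2) that by auto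
  have "(\<lambda>i. \<integral>x. (f (X i) x - f t x) / (X i - t) \<partial>M) \<longlonglongrightarrow> (\<integral>x. f' t x \<partial>M)"
  proof (rule integral_dominated_convergence[where w=w])
    show "AE x in M. (\<lambda>i. (f (X i) x - f t x) / (X i - t)) \<longlonglongrightarrow> f' t x"
    proof (rule AE_I2)
      fix x assume "x \<in> space M"
      from der[OF this, of t, unfolded has_field_derivative_iff tendsto_at_iff_sequentially, rule_format, OF _ lim] X
      show "(\<lambda>i. (f (X i) x - f t x) / (X i - t)) \<longlonglongrightarrow> f' t x" by (auto simp: o_def)
    qed
    show "AE x in M. norm ((f (X i) x - f t x) / (X i - t)) \<le> w x" for i
      using lip X by (auto intro!: AE_I2 simp: divide_le_eq)
  qed (use w in auto)
  then show "((\<lambda>y. ((\<integral>x. f y x \<partial>M) - (\<integral>x. f t x \<partial>M)) / (y - t)) \<circ> X) \<longlonglongrightarrow> (\<integral>x. f' t x \<partial>M)"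
    using int by (simp add: o_def)
qed

section \<open>Comparison by Gaussian interpolation\<close>

lemma inner_on_upd:
  assumes "finite K" "k \<in> K"
  shows "inner_on K b (\<xi>(k := y)) = b k * y + inner_on (K - {k}) b \<xi>"
  unfolding inner_on_def by (subst sum.remove[OF assms]) (auto intro!: sum.cong)

text \<open>\<open>g\<close> is meant as a smooth surrogate for the indicator of [-T, T]. The
  comparison bound depends on \<open>L\<close>, whose growth with T must therefore be tracked;
  \<open>C\<close> secures boundedness and integrability.\<close>

locale cutoff =
  fixes g g' g'' :: "real \<Rightarrow> real" and T L C :: real
  assumes deriv_g: "\<And>x. (g has_real_derivative g' x) (at x)"
    and deriv_g': "\<And>x. (g' has_real_derivative g'' x) (at x)"
    and cont_g'': "\<And>x. isCont g'' x"
    and g_range: "\<And>x. 0 \<le> g x" "\<And>x. g x \<le> 1"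
    and g'_bound: "\<And>x. \<bar>g' x\<bar> \<le> L"
    and g''_bound: "\<And>x. \<bar>g'' x\<bar> \<le> C"
    and T_nonneg: "0 \<le> T"
    and g'_support: "\<And>x. g' x \<noteq> 0 \<Longrightarrow> T \<le> \<bar>x\<bar>"
begin

lemma isCont_g: "isCont g x" and isCont_g': "isCont g' x"
  using deriv_g deriv_g' DERIV_isCont by blast+

lemma measurable_g [measurable]:
  "g \<in> borel_measurable borel" "g' \<in> borel_measurable borel" "g'' \<in> borel_measurable borel"
  using isCont_g isCont_g' cont_g''
  by (auto intro!: borel_measurable_continuous_onI continuous_at_imp_continuous_on)

lemma L_nonneg: "0 \<le> L" and C_nonneg: "0 \<le> C"
  using order_trans[OF abs_ge_zero g'_bound] order_trans[OF abs_ge_zero g''_bound] by auto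

definition cutoff_prod :: "'k set \<Rightarrow> 'w set \<Rightarrow> ('w \<Rightarrow> 'k \<Rightarrow> real) \<Rightarrow> ('k \<Rightarrow> real) \<Rightarrow> real" where
  "cutoff_prod K G b \<xi> = (\<Prod>i\<in>G. g (inner_on K (b i) \<xi>))"

definition cutoff_prod' :: "'k set \<Rightarrow> 'w set \<Rightarrow> ('w \<Rightarrow> 'k \<Rightarrow> real) \<Rightarrow> 'w \<Rightarrow> ('k \<Rightarrow> real) \<Rightarrow> real" where
  "cutoff_prod' K G b i \<xi> = g' (inner_on K (b i) \<xi>) * (\<Prod>j\<in>G - {i}. g (inner_on K (b j) \<xi>))"

text \<open>The Hessian of the product with respect to its slots, not to the coordinates of \<xi>.
  The chain rule factors \<open>b j k\<close> stay outside, where they recombine to inner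
  products.\<close>

definition cutoff_prod'' ::
    "'k set \<Rightarrow> 'w set \<Rightarrow> ('w \<Rightarrow> 'k \<Rightarrow> real) \<Rightarrow> 'w \<Rightarrow> 'w \<Rightarrow> ('k \<Rightarrow> real) \<Rightarrow> real" where
  "cutoff_prod'' K G b i j \<xi> =
     (if i = j then g'' (inner_on K (b i) \<xi>) * (\<Prod>l\<in>G - {i}. g (inner_on K (b l) \<xi>))
      else g' (inner_on K (b i) \<xi>) * g' (inner_on K (b j) \<xi>) * (\<Prod>l\<in>G - {i} - {j}. g (inner_on K (b l) \<xi>)))"

lemma measurable_cutoff_prod [measurable]:
  "cutoff_prod K G b \<in> borel_measurable (gauss K)"
  "cutoff_prod' K G b i \<in> borel_measurable (gauss K)"
  "cutoff_prod'' K G b i j \<in> borel_measurable (gauss K)"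
  unfolding cutoff_prod_def[abs_def] cutoff_prod'_def[abs_def] cutoff_prod''_def[abs_def] by measurable

lemma abs_prod_g: "\<bar>\<Prod>l\<in>A. g (x l)\<bar> \<le> 1"
  using g_range by (auto simp: abs_prod intro!: prod_le_1)

lemma abs_cutoff_prod: "\<bar>cutoff_prod K G b \<xi>\<bar> \<le> 1"
  unfolding cutoff_prod_def by (rule abs_prod_g)

lemma abs_cutoff_prod': "\<bar>cutoff_prod' K G b i \<xi>\<bar> \<le> L"
  unfolding cutoff_prod'_def abs_mult using mult_mono[OF g'_bound abs_prod_g L_nonneg] by simp

lemma abs_g''_prod: "\<bar>g'' x * (\<Prod>l\<in>A. g (y l))\<bar> \<le> C"
  unfolding abs_mult using mult_mono[OF g''_bound abs_prod_g C_nonneg] by simp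

lemma abs_g'_g'_prod: "\<bar>g' x * g' z * (\<Prod>l\<in>A. g (y l))\<bar> \<le> L\<^sup>2"
  unfolding abs_mult power2_eq_square
  using mult_mono[OF mult_mono[OF g'_bound g'_bound L_nonneg] abs_prod_g] L_nonneg by simp

lemma abs_cutoff_prod'': "\<bar>cutoff_prod'' K G b i j \<xi>\<bar> \<le> C + L\<^sup>2"
  unfolding cutoff_prod''_def
  by (auto intro: add_increasing2[OF zero_le_power2 abs_g''_prod] add_increasing[OF C_nonneg abs_g'_g'_prod])

text \<open>Stein's identity in coordinate k yields the factor \<open>b j k\<close>; weighting by
  \<open>v k\<close> and summing over k collects these factors into the covariance of the forms
  \<open>v\<close> and \<open>b j\<close>.\<close>

lemma integral_inner_on_cutoff_prod':
  assumes K: "finite K" and G: "finite G" "i \<in> G"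
  shows "(\<integral>\<xi>. inner_on K v \<xi> * cutoff_prod' K G b i \<xi> \<partial>gauss K)
    = (\<Sum>j\<in>G. inner_on K v (b j) * (\<integral>\<xi>. cutoff_prod'' K G b i j \<xi> \<partial>gauss K))"
proof -
  interpret P: prob_space "gauss K" by (rule prob_space_gauss)
  let ?H = "cutoff_prod' K G b i" and ?D = "cutoff_prod'' K G b i"
  have intD: "integrable (gauss K) (?D j)" for j
    by (rule P.integrable_const_bound[where B="C + L\<^sup>2"]) (auto simp: abs_cutoff_prod'')
  have intH: "integrable (gauss K) (\<lambda>\<xi>. \<xi> k * ?H \<xi>)" if "k \<in> K" for k
  proof (rule Bochner_Integration.integrable_bound[OF integrable_mult_right[OF integrable_component_gauss[OF that], of L]])
    show "(\<lambda>\<xi>. \<xi> k * ?H \<xi>) \<in> borel_measurable (gauss K)"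
      using borel_measurable_integrable[OF integrable_component_gauss[OF that]] by measurable
    show "AE \<xi> in gauss K. norm (\<xi> k * ?H \<xi>) \<le> norm (L * \<xi> k)"
      using mult_left_mono[OF abs_cutoff_prod' abs_ge_zero] L_nonneg
      by (auto simp: abs_mult mult.commute[of L] intro!: AE_I2)
  qed
  have stein: "(\<integral>\<xi>. \<xi> k * ?H \<xi> \<partial>gauss K) = (\<Sum>j\<in>G. b j k * (\<integral>\<xi>. ?D j \<xi> \<partial>gauss K))" if k: "k \<in> K" for k
  proof -
    have X: "((\<lambda>y. inner_on K (b j) (\<xi>(k := y))) has_real_derivative b j k) (at y)" for j \<xi> y
      unfolding inner_on_upd[OF K k] by (auto intro!: derivative_eq_intros)
    have cX: "isCont (\<lambda>y. inner_on K (b j) (\<xi>(k := y))) y" for j \<xi> y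
      using X by (rule DERIV_isCont)
    have "(\<integral>\<xi>. \<xi> k * ?H \<xi> \<partial>gauss K) = (\<integral>\<xi>. (\<Sum>j\<in>G. b j k * ?D j \<xi>) \<partial>gauss K)"
    proof (rule stein_gauss[OF K k])
      show "\<bar>?H \<xi>\<bar> \<le> L" for \<xi> by (rule abs_cutoff_prod')
      show "\<bar>\<Sum>j\<in>G. b j k * ?D j \<xi>\<bar> \<le> (\<Sum>j\<in>G. \<bar>b j k\<bar> * (C + L\<^sup>2))" for \<xi>
        by (rule order_trans[OF sum_abs sum_mono]) (simp add: abs_mult mult_left_mono abs_cutoff_prod'')
      show "isCont (\<lambda>y. \<Sum>j\<in>G. b j k * ?D j (\<xi>(k := y))) y" for \<xi> y
      proof (intro continuous_intros)
        show "isCont (\<lambda>y. ?D j (\<xi>(k := y))) y" for j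
          unfolding cutoff_prod''_def
          by (cases "i = j") (auto intro!: continuous_intros isCont_o2[OF cX] isCont_g isCont_g' cont_g'')
      qed
      fix \<xi> y
      let ?x = "\<lambda>j. inner_on K (b j) (\<xi>(k := y))"
      \<comment> \<open>Product rule: the factor with index i gives the Hessian entry (i, i), each
        factor j \<noteq> i the entry (i, j).\<close>
      have "((\<lambda>y. ?H (\<xi>(k := y))) has_real_derivative
          (g'' (?x i) * b i k * (\<Prod>j\<in>G - {i}. g (?x j))
           + (\<Sum>j\<in>G - {i}. g' (?x j) * b j k * (\<Prod>l\<in>G - {i} - {j}. g (?x l))) * g' (?x i))) (at y)"
        unfolding cutoff_prod'_def
        by (intro DERIV_mult has_field_derivative_prod DERIV_chain2[OF deriv_g' X] DERIV_chain2[OF deriv_g X])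
      also have "g'' (?x i) * b i k * (\<Prod>j\<in>G - {i}. g (?x j))
           + (\<Sum>j\<in>G - {i}. g' (?x j) * b j k * (\<Prod>l\<in>G - {i} - {j}. g (?x l))) * g' (?x i)
          = (\<Sum>j\<in>G. b j k * ?D j (\<xi>(k := y)))"
        by (subst sum.remove[OF G])
          (auto simp: cutoff_prod''_def sum_distrib_left sum_distrib_right mult_ac intro!: sum.cong split: if_splits)
      finally show "((\<lambda>y. ?H (\<xi>(k := y))) has_real_derivative (\<Sum>j\<in>G. b j k * ?D j (\<xi>(k := y)))) (at y)" .
    qed measurable
    also have "\<dots> = (\<Sum>j\<in>G. b j k * (\<integral>\<xi>. ?D j \<xi> \<partial>gauss K))"
      using intD by simp
    finally show ?thesis .
  qed
  have "(\<integral>\<xi>. inner_on K v \<xi> * ?H \<xi> \<partial>gauss K) = (\<integral>\<xi>. (\<Sum>k\<in>K. v k * (\<xi> k * ?H \<xi>)) \<partial>gauss K)"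
    by (simp add: inner_on_def sum_distrib_right mult.assoc)
  also have "\<dots> = (\<Sum>k\<in>K. v k * (\<Sum>j\<in>G. b j k * (\<integral>\<xi>. ?D j \<xi> \<partial>gauss K)))"
    using intH stein by (subst Bochner_Integration.integral_sum) auto
  also have "\<dots> = (\<Sum>j\<in>G. inner_on K v (b j) * (\<integral>\<xi>. ?D j \<xi> \<partial>gauss K))"
    unfolding inner_on_def sum_distrib_left sum_distrib_right
    by (subst sum.swap) (simp add: mult.assoc)
  finally show ?thesis .
qed

text \<open>An off-diagonal entry contains g' at both forms, so it vanishes unless both reach T in
  modulus; on that event it is at most L^2.\<close>

lemma integral_cutoff_prod''_le:
  assumes K: "finite K" and "i \<noteq> j" and b: "inner_on K (b i) (b i) = 1" "inner_on K (b j) (b j) = 1"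
    and r: "\<bar>inner_on K (b i) (b j)\<bar> \<le> r"
  shows "\<bar>\<integral>\<xi>. cutoff_prod'' K G b i j \<xi> \<partial>gauss K\<bar> \<le> 4 * L\<^sup>2 * exp (- T\<^sup>2 / (1 + r))"
proof -
  interpret P: prob_space "gauss K" by (rule prob_space_gauss)
  define E where "E = {\<xi>\<in>space (gauss K). T \<le> \<bar>inner_on K (b i) \<xi>\<bar> \<and> T \<le> \<bar>inner_on K (b j) \<xi>\<bar>}"
  have [measurable]: "E \<in> sets (gauss K)" unfolding E_def by measurable
  have le: "\<bar>cutoff_prod'' K G b i j \<xi>\<bar> \<le> L\<^sup>2 * indicator E \<xi>" if "\<xi> \<in> space (gauss K)" for \<xi>
  proof (cases "\<xi> \<in> E")
    case True
    then show ?thesis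
      using \<open>i \<noteq> j\<close> by (simp add: cutoff_prod''_def abs_g'_g'_prod)
  next
    case False
    then have "g' (inner_on K (b i) \<xi>) = 0 \<or> g' (inner_on K (b j) \<xi>) = 0"
      using g'_support that by (auto simp: E_def)
    then show ?thesis using False \<open>i \<noteq> j\<close> by (auto simp: cutoff_prod''_def)
  qed
  have "\<bar>\<integral>\<xi>. cutoff_prod'' K G b i j \<xi> \<partial>gauss K\<bar> \<le> (\<integral>\<xi>. \<bar>cutoff_prod'' K G b i j \<xi>\<bar> \<partial>gauss K)"
    by (rule integral_abs_bound)
  also have "\<dots> \<le> (\<integral>\<xi>. L\<^sup>2 * indicator E \<xi> \<partial>gauss K)"
  proof (intro integral_mono le)
    show "integrable (gauss K) (\<lambda>\<xi>. \<bar>cutoff_prod'' K G b i j \<xi>\<bar>)"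
      by (rule P.integrable_const_bound[where B="C + L\<^sup>2"]) (auto simp: abs_cutoff_prod'')
    show "integrable (gauss K) (\<lambda>\<xi>. L\<^sup>2 * indicator E \<xi>)"
      by (intro integrable_mult_right) (simp add: P.emeasure_eq_measure)
  qed
  also have "\<dots> = L\<^sup>2 * measure (gauss K) E"
    by simp
  also have "measure (gauss K) E \<le> 4 * exp (- T\<^sup>2 / (1 + r))"
    unfolding E_def by (rule gauss_joint_tail[OF K b r T_nonneg])
  finally show ?thesis by (simp add: mult_left_mono mult.left_commute mult.commute[of 4])
qed

text \<open>
  Along the rotation \<open>sin t a + cos t c\<close> the diagonal terms, which involve \<open>g''\<close>, cancel because
  \<open>a i\<close> and \<open>c i\<close> have the same norm.
\<close>

theorem gauss_comparison:
  assumes K: "finite K" and G: "finite G"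
    and a: "\<And>i. i \<in> G \<Longrightarrow> inner_on K (a i) (a i) = 1"
    and c: "\<And>i j. i \<in> G \<Longrightarrow> j \<in> G \<Longrightarrow> inner_on K (c i) (c j) = (if i = j then 1 else 0)"
    and ac: "\<And>i j. i \<in> G \<Longrightarrow> j \<in> G \<Longrightarrow> inner_on K (a i) (c j) = 0"
  shows "\<bar>(\<integral>\<xi>. cutoff_prod K G a \<xi> \<partial>gauss K) - (\<integral>\<xi>. cutoff_prod K G c \<xi> \<partial>gauss K)\<bar>
    \<le> 2 * pi * L\<^sup>2 * (\<Sum>i\<in>G. \<Sum>j\<in>G - {i}. \<bar>inner_on K (a i) (a j)\<bar> * exp (- T\<^sup>2 / (1 + \<bar>inner_on K (a i) (a j)\<bar>)))"
    (is "_ \<le> _ * ?S")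
proof -
  interpret P: prob_space "gauss K" by (rule prob_space_gauss)
  \<comment> \<open>\<open>b t\<close> runs from \<open>c\<close> at t = 0 to \<open>a\<close> at t
    = pi / 2, and \<open>v t\<close> is its derivative in t.\<close>
  define b where "b t i k = sin t * a i k + cos t * c i k" for t i k
  define v where "v t i k = cos t * a i k - sin t * c i k" for t i k
  have ca: "inner_on K (c i) (a j) = 0" if "i \<in> G" "j \<in> G" for i j
    using ac[OF that(2,1)] by (simp add: inner_on_commute)
  define F where "F t = (\<integral>\<xi>. cutoff_prod K G (b t) \<xi> \<partial>gauss K)" for t
  define f' where "f' t \<xi> = (\<Sum>i\<in>G. inner_on K (v t i) \<xi> * cutoff_prod' K G (b t) i \<xi>)" for t \<xi>
  have bi: "inner_on K (b t i) \<xi> = sin t * inner_on K (a i) \<xi> + cos t * inner_on K (c i) \<xi>" for t i \<xi>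
    unfolding b_def by (simp add: inner_on_linear)
  have vi: "inner_on K (v t i) \<xi> = cos t * inner_on K (a i) \<xi> - sin t * inner_on K (c i) \<xi>" for t i \<xi>
    unfolding v_def by (simp add: inner_on_linear)
  have br: "inner_on K u (b t i) = sin t * inner_on K u (a i) + cos t * inner_on K u (c i)" for t i u
    unfolding b_def by (simp add: inner_on_linear)
  \<comment> \<open>A majorant of the derivative that does not depend on t, as sine and cosine are
    at most 1 in modulus.\<close>
  define w where "w \<xi> = (\<Sum>i\<in>G. (\<bar>inner_on K (a i) \<xi>\<bar> + \<bar>inner_on K (c i) \<xi>\<bar>) * L)" for \<xi>
  have v_le: "\<bar>inner_on K (v t i) \<xi>\<bar> \<le> \<bar>inner_on K (a i) \<xi>\<bar> + \<bar>inner_on K (c i) \<xi>\<bar>" for t i \<xi>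
    unfolding vi by (intro order_trans[OF abs_triangle_ineq4] add_mono)
      (auto simp: abs_mult intro!: mult_left_le_one_le)
  have v_cutoff: "\<bar>inner_on K (v t i) \<xi> * cutoff_prod' K G (b t) i \<xi>\<bar>
      \<le> (\<bar>inner_on K (a i) \<xi>\<bar> + \<bar>inner_on K (c i) \<xi>\<bar>) * L" for t i \<xi>
    unfolding abs_mult by (intro mult_mono v_le abs_cutoff_prod') auto
  have int_w: "integrable (gauss K) (\<lambda>\<xi>. (\<bar>inner_on K (a i) \<xi>\<bar> + \<bar>inner_on K (c i) \<xi>\<bar>) * L)" for i
    by (intro integrable_mult_left Bochner_Integration.integrable_add integrable_abs integrable_inner_on)
  have int_v: "integrable (gauss K) (\<lambda>\<xi>. inner_on K (v t i) \<xi> * cutoff_prod' K G (b t) i \<xi>)" for t i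
    by (rule Bochner_Integration.integrable_bound[OF int_w])
      (use v_cutoff in \<open>auto intro!: AE_I2 intro: order_trans[OF _ abs_ge_self]\<close>)
  have der: "(F has_real_derivative (\<integral>\<xi>. f' t \<xi> \<partial>gauss K)) (at t)" for t
    unfolding F_def
  proof (rule has_real_derivative_integral[where w=w])
    show "integrable (gauss K) (cutoff_prod K G (b t))" for t
      by (rule P.integrable_const_bound[where B=1]) (auto simp: abs_cutoff_prod)
    show "integrable (gauss K) w"
      unfolding w_def by (intro Bochner_Integration.integrable_sum int_w)
    show "f' t \<in> borel_measurable (gauss K)" for t
      unfolding f'_def by measurable
    show "\<bar>f' t \<xi>\<bar> \<le> w \<xi>" for t \<xi>
      unfolding f'_def w_def by (rule order_trans[OF sum_abs sum_mono[OF v_cutoff]])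
    have X: "((\<lambda>t. inner_on K (b t i) \<xi>) has_real_derivative inner_on K (v t i) \<xi>) (at t)" for t i \<xi>
      unfolding bi vi by (auto intro!: derivative_eq_intros simp: mult.commute)
    show "((\<lambda>t. cutoff_prod K G (b t) \<xi>) has_real_derivative f' t \<xi>) (at t)" for t \<xi>
      unfolding cutoff_prod_def f'_def cutoff_prod'_def
      using has_field_derivative_prod[OF DERIV_chain2[OF deriv_g X], where A=G]
      by (simp add: mult_ac)
  qed
  have bound: "\<bar>\<integral>\<xi>. f' t \<xi> \<partial>gauss K\<bar> \<le> 4 * L\<^sup>2 * ?S" for t
  proof -
    let ?D = "\<lambda>i j. (\<integral>\<xi>. cutoff_prod'' K G (b t) i j \<xi> \<partial>gauss K)"
    \<comment> \<open>All rotated forms have variance 1, and their correlations are those of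
      \<open>a\<close> shrunk by sin^2 t. One joint tail bound thus serves every t.\<close>
    have bb: "inner_on K (b t i) (b t j) = (if i = j then 1 else (sin t)\<^sup>2 * inner_on K (a i) (a j))"
      if "i \<in> G" "j \<in> G" for i j
      using that a[of i] a[of j] ac ca c sin_cos_squared_add[of t]
      by (cases "i = j") (simp_all add: bi br power2_eq_square)
    have vb: "inner_on K (v t i) (b t j) = (if i = j then 0 else sin t * cos t * inner_on K (a i) (a j))"
      if "i \<in> G" "j \<in> G" for i j
      using that a[of i] a[of j] ac ca c
      by (cases "i = j") (simp_all add: vi br algebra_simps)
    have "(\<integral>\<xi>. f' t \<xi> \<partial>gauss K) = (\<Sum>i\<in>G. \<integral>\<xi>. inner_on K (v t i) \<xi> * cutoff_prod' K G (b t) i \<xi> \<partial>gauss K)"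
      unfolding f'_def by (rule Bochner_Integration.integral_sum[OF int_v])
    also have "\<dots> = (\<Sum>i\<in>G. \<Sum>j\<in>G. inner_on K (v t i) (b t j) * ?D i j)"
      by (intro sum.cong refl integral_inner_on_cutoff_prod' K G)
    also have "\<dots> = (\<Sum>i\<in>G. \<Sum>j\<in>G - {i}. sin t * cos t * inner_on K (a i) (a j) * ?D i j)"
    proof (rule sum.cong[OF refl])
      fix i assume i: "i \<in> G"
      have "inner_on K (v t i) (b t j) = sin t * cos t * inner_on K (a i) (a j)" if "j \<in> G - {i}" for j
        using vb[OF i, of j] that by auto
      then show "(\<Sum>j\<in>G. inner_on K (v t i) (b t j) * ?D i j)
          = (\<Sum>j\<in>G - {i}. sin t * cos t * inner_on K (a i) (a j) * ?D i j)"
        unfolding sum.remove[OF G i] by (simp add: vb i)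
    qed
    finally have eq: "(\<integral>\<xi>. f' t \<xi> \<partial>gauss K)
        = (\<Sum>i\<in>G. \<Sum>j\<in>G - {i}. sin t * cos t * inner_on K (a i) (a j) * ?D i j)" .
    have "\<bar>\<integral>\<xi>. f' t \<xi> \<partial>gauss K\<bar> \<le> (\<Sum>i\<in>G. \<Sum>j\<in>G - {i}. \<bar>inner_on K (a i) (a j)\<bar> *
        (4 * L\<^sup>2 * exp (- T\<^sup>2 / (1 + \<bar>inner_on K (a i) (a j)\<bar>))))"
      unfolding eq
    proof (intro order_trans[OF sum_abs sum_mono])
      fix i j assume ij: "i \<in> G" "j \<in> G - {i}"
      have sc: "\<bar>sin t * cos t\<bar> \<le> 1"
        unfolding abs_mult by (rule mult_le_one) auto
      have "\<bar>inner_on K (b t i) (b t j)\<bar> \<le> \<bar>inner_on K (a i) (a j)\<bar>"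
        using bb[of i j] ij by (cases "i = j") (simp_all add: abs_mult abs_square_le_1 mult_left_le_one_le)
      then have "\<bar>?D i j\<bar> \<le> 4 * L\<^sup>2 * exp (- T\<^sup>2 / (1 + \<bar>inner_on K (a i) (a j)\<bar>))"
        using ij by (intro integral_cutoff_prod''_le K) (auto simp: bb)
      then have "\<bar>sin t * cos t\<bar> * \<bar>inner_on K (a i) (a j)\<bar> * \<bar>?D i j\<bar> \<le> 1 * \<bar>inner_on K (a i) (a j)\<bar> *
          (4 * L\<^sup>2 * exp (- T\<^sup>2 / (1 + \<bar>inner_on K (a i) (a j)\<bar>)))"
        using sc by (intro mult_mono) auto
      then show "\<bar>sin t * cos t * inner_on K (a i) (a j) * ?D i j\<bar> \<le> \<bar>inner_on K (a i) (a j)\<bar> *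
          (4 * L\<^sup>2 * exp (- T\<^sup>2 / (1 + \<bar>inner_on K (a i) (a j)\<bar>)))"
        by (simp add: abs_mult)
    qed
    also have "\<dots> = 4 * L\<^sup>2 * ?S"
      by (simp add: sum_distrib_left mult_ac)
    finally show ?thesis .
  qed
  \<comment> \<open>The mean value bound over length pi / 2 turns the 4 sign choices of the joint
    tail into the constant 2 pi.\<close>
  have "\<bar>F (pi / 2) - F 0\<bar> \<le> 4 * L\<^sup>2 * ?S * \<bar>pi / 2 - 0\<bar>"
    using field_differentiable_bound[of UNIV F "\<lambda>t. \<integral>\<xi>. f' t \<xi> \<partial>gauss K" "4 * L\<^sup>2 * ?S" "pi/2" 0] der bound by simp
  also have "\<dots> = 2 * pi * L\<^sup>2 * ?S" by simp
  finally show ?thesis by (simp add: F_def b_def[abs_def])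
qed

end

section \<open>A smooth cutoff and decoupling\<close>

text \<open>The only delicate point is 0. Because the exponent is at least 2, the difference
  quotient there is at most |y|^(n + 1).\<close>

lemma has_real_derivative_max_0_power:
  fixes x :: real
  shows "((\<lambda>x. max 0 x ^ Suc (Suc n)) has_real_derivative real (Suc (Suc n)) * max 0 x ^ Suc n) (at x)"
proof -
  consider "x > 0" | "x < 0" | "x = 0" by linarith
  then show ?thesis
  proof cases
    case 1
    have "((\<lambda>x. x ^ Suc (Suc n)) has_real_derivative real (Suc (Suc n)) * max 0 x ^ Suc n) (at x)"
      using 1 DERIV_pow[of "Suc (Suc n)" x] by simp
    then show ?thesis
      by (rule has_field_derivative_transform_within_open[where S="{0<..}"]) (use 1 in auto)
  next
    case 2
    have "((\<lambda>x. 0) has_real_derivative real (Suc (Suc n)) * max 0 x ^ Suc n) (at x)"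
      using 2 by simp
    then show ?thesis
      by (rule has_field_derivative_transform_within_open[where S="{..<0}"]) (use 2 in auto)
  next
    case 3
    have "((\<lambda>y::real. max 0 y ^ Suc (Suc n) / y) \<longlongrightarrow> 0) (at 0)"
    proof (rule Lim_null_comparison)
      show "\<forall>\<^sub>F y in at (0::real). norm (max 0 y ^ Suc (Suc n) / y) \<le> \<bar>y\<bar> ^ Suc n"
      proof (intro always_eventually allI)
        fix y :: real
        show "norm (max 0 y ^ Suc (Suc n) / y) \<le> \<bar>y\<bar> ^ Suc n"
        proof (cases "0 \<le> y")
          case False
          then have "max 0 y = 0" by simp
          then show ?thesis by (simp only: power_0_Suc div_0 norm_zero zero_le_power abs_ge_zero)
        qed simp
      qed
      have "((\<lambda>y::real. \<bar>y\<bar> ^ Suc n) \<longlongrightarrow> \<bar>0\<bar> ^ Suc n) (at 0)"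
        by (intro tendsto_intros)
      then show "((\<lambda>y::real. \<bar>y\<bar> ^ Suc n) \<longlongrightarrow> 0) (at 0)" by simp
    qed
    then show ?thesis
      unfolding has_field_derivative_iff 3 by simp
  qed
qed

text \<open>The quintic q(x) = 6 x^5 - 15 x^4 + 10 x^3 on [0, 1], continued by 0 and 1. Truncated
  powers avoid gluing: the second line subtracts q(1 + y) - 1 = 6 y^5 + 15 y^4 + 10 y^3 beyond
  1.\<close>

definition smoothstep :: "real \<Rightarrow> real" where
  "smoothstep x = 6 * max 0 x ^ 5 - 15 * max 0 x ^ 4 + 10 * max 0 x ^ 3
     - 6 * max 0 (x - 1) ^ 5 - 15 * max 0 (x - 1) ^ 4 - 10 * max 0 (x - 1) ^ 3"

text \<open>Since x (1 - x) is positive exactly on (0, 1), truncating it at 0 encodes both the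
  support and the polynomial 30 x^2 (1 - x)^2; the square keeps it differentiable.\<close>

definition smoothstep' :: "real \<Rightarrow> real" where
  "smoothstep' x = 30 * (max 0 (x * (1 - x)))\<^sup>2"

definition smoothstep'' :: "real \<Rightarrow> real" where
  "smoothstep'' x = 60 * max 0 (x * (1 - x)) * (1 - 2 * x)"

lemma DERIV_smoothstep: "(smoothstep has_real_derivative smoothstep' x) (at x)"
proof -
  have P: "((\<lambda>x. max 0 (x - c) ^ Suc (Suc n)) has_real_derivative real (Suc (Suc n)) * max 0 (x - c) ^ Suc n) (at x)"
    for n c
  proof -
    have "((\<lambda>x. x - c) has_real_derivative 1) (at x)" by (auto intro!: derivative_eq_intros)
    from DERIV_chain2[OF has_real_derivative_max_0_power this] show ?thesis by (simp only: mult_1_right)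
  qed
  have P5: "((\<lambda>x. max 0 (x - c) ^ 5) has_real_derivative 5 * max 0 (x - c) ^ 4) (at x)"
    and P4: "((\<lambda>x. max 0 (x - c) ^ 4) has_real_derivative 4 * max 0 (x - c) ^ 3) (at x)"
    and P3: "((\<lambda>x. max 0 (x - c) ^ 3) has_real_derivative 3 * max 0 (x - c) ^ 2) (at x)" for c
    using P[of c 3] P[of c 2] P[of c 1] by (simp_all add: eval_nat_numeral)
  have "(smoothstep has_real_derivative
      6 * (5 * max 0 x ^ 4) - 15 * (4 * max 0 x ^ 3) + 10 * (3 * max 0 x ^ 2)
       - 6 * (5 * max 0 (x - 1) ^ 4) - 15 * (4 * max 0 (x - 1) ^ 3) - 10 * (3 * max 0 (x - 1) ^ 2)) (at x)"
    unfolding smoothstep_def[abs_def]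
    by (intro DERIV_diff DERIV_add DERIV_cmult P3 P4 P5 P3[of 0, simplified] P4[of 0, simplified] P5[of 0, simplified])
  also have "6 * (5 * max 0 x ^ 4) - 15 * (4 * max 0 x ^ 3) + 10 * (3 * max 0 x ^ 2)
       - 6 * (5 * max 0 (x - 1) ^ 4) - 15 * (4 * max 0 (x - 1) ^ 3) - 10 * (3 * max 0 (x - 1) ^ 2) = smoothstep' x"
  proof -
    consider "x \<le> 0" | "0 \<le> x" "x \<le> 1" | "1 \<le> x" by linarith
    then show ?thesis
    proof cases
      case 1
      then have "x * (1 - x) \<le> 0" by (intro mult_nonpos_nonneg) auto
      with 1 show ?thesis by (simp add: smoothstep'_def max_def)
    next
      case 2
      then have "max 0 (x * (1 - x)) = x * (1 - x)" "max 0 x = x" "max 0 (x - 1) = 0" by auto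
      then show ?thesis
        unfolding smoothstep'_def by (simp add: eval_nat_numeral algebra_simps)
    next
      case 3
      then have "x * (1 - x) \<le> 0" by (simp add: mult_le_0_iff)
      with 3 have "max 0 (x * (1 - x)) = 0" "max 0 x = x" "max 0 (x - 1) = x - 1"
        by auto
      then show ?thesis
        unfolding smoothstep'_def by (simp add: eval_nat_numeral algebra_simps)
    qed
  qed
  finally show ?thesis .
qed

lemma DERIV_smoothstep': "(smoothstep' has_real_derivative smoothstep'' x) (at x)"
proof -
  have "((\<lambda>x. x * (1 - x)) has_real_derivative 1 - 2 * x) (at x)"
    by (auto intro!: derivative_eq_intros)
  from DERIV_cmult[OF DERIV_chain2[OF has_real_derivative_max_0_power[of 0] this], of 30] show ?thesis
    by (simp add: smoothstep'_def[abs_def] smoothstep''_def numeral_2_eq_2 mult.assoc)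
qed

lemma isCont_smoothstep'': "isCont smoothstep'' x"
  unfolding smoothstep''_def[abs_def] by (intro continuous_intros)

lemma smoothstep_eq_0: "x \<le> 0 \<Longrightarrow> smoothstep x = 0"
  by (simp add: smoothstep_def max_def)

lemma smoothstep_eq_1: "1 \<le> x \<Longrightarrow> smoothstep x = 1"
  by (simp add: smoothstep_def max_def) (simp add: eval_nat_numeral algebra_simps)

text \<open>The square 6 y^2 - 15 y + 10 = 6 (y - 5/4)^2 + 5/8 gives positivity; the symmetry 1 -
  q(x) = q(1 - x) turns it into the upper bound.\<close>

lemma smoothstep_range: "0 \<le> smoothstep x" "smoothstep x \<le> 1"
proof -
  have p: "0 \<le> 6 * y ^ 5 - 15 * y ^ 4 + 10 * y ^ 3" if "0 \<le> y" for y :: real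
  proof -
    have "0 \<le> y ^ 3 * (6 * (y - 5/4)\<^sup>2 + 5/8)" using that by simp
    also have "\<dots> = 6 * y ^ 5 - 15 * y ^ 4 + 10 * y ^ 3"
      by (simp add: eval_nat_numeral field_simps)
    finally show ?thesis .
  qed
  have "0 \<le> smoothstep x \<and> smoothstep x \<le> 1"
  proof (cases "0 \<le> x \<and> x \<le> 1")
    case True
    have "1 - (6 * x ^ 5 - 15 * x ^ 4 + 10 * x ^ 3) = 6 * (1 - x) ^ 5 - 15 * (1 - x) ^ 4 + 10 * (1 - x) ^ 3"
      by (simp add: eval_nat_numeral field_simps)
    then show ?thesis using p[of x] p[of "1 - x"] True by (simp add: smoothstep_def max_absorb1 max_absorb2)
  qed (use smoothstep_eq_0[of x] smoothstep_eq_1[of x] in fastforce)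
  then show "0 \<le> smoothstep x" "smoothstep x \<le> 1" by auto
qed

lemma smoothstep_deriv_support:
  assumes "\<not> (0 \<le> x \<and> x \<le> 1)"
  shows "smoothstep' x = 0" "smoothstep'' x = 0"
proof -
  have "x * (1 - x) \<le> 0" using assms by (auto simp: mult_le_0_iff)
  then show "smoothstep' x = 0" "smoothstep'' x = 0" by (auto simp: smoothstep'_def smoothstep''_def)
qed

text \<open>From x (1 - x) \<le> 1/4 one gets 30/16 \<le> 2 and 60/4 = 15.\<close>

lemma abs_smoothstep_deriv_le: "\<bar>smoothstep' x\<bar> \<le> 2" "\<bar>smoothstep'' x\<bar> \<le> 15"
proof -
  define m where "m = max 0 (x * (1 - x))"
  have "x * (1 - x) = 1/4 - (x - 1/2)\<^sup>2" by (simp add: power2_eq_square field_simps)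
  then have "x * (1 - x) \<le> 1/4" by simp
  then have m: "0 \<le> m" "m \<le> 1/4" by (auto simp: m_def)
  have "m\<^sup>2 \<le> (1/4)\<^sup>2" using m by (intro power_mono) auto
  then show "\<bar>smoothstep' x\<bar> \<le> 2" by (simp add: smoothstep'_def m_def[symmetric] power2_eq_square)
  show "\<bar>smoothstep'' x\<bar> \<le> 15"
  proof (cases "0 \<le> x \<and> x \<le> 1")
    case True
    then have "m * \<bar>1 - 2 * x\<bar> \<le> 1/4 * 1" using m by (intro mult_mono) auto
    then show ?thesis using m by (simp add: smoothstep''_def m_def[symmetric] abs_mult)
  qed (use smoothstep_deriv_support in auto)
qed

text \<open>Compose the step with (x^2 - T^2) / \<delta>. On the window T \<le> |x| \<le> R the
  inner derivative is at most 2 R / \<delta>, and \<open>smoothstep'\<close> is at most 2, whence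
  the slope 4 R / \<delta> with R = \<open>sqrt (T\<^sup>2 + \<delta>)\<close>.\<close>

lemma cutoff_exists:
  fixes T \<delta> :: real
  assumes T: "0 \<le> T" and \<delta>: "0 < \<delta>"
  obtains g g' g'' C where "cutoff g g' g'' T (4 * sqrt (T\<^sup>2 + \<delta>) / \<delta>) C"
    "\<And>x. \<bar>x\<bar> \<le> T \<Longrightarrow> g x = 1" "\<And>x. T\<^sup>2 + \<delta> \<le> x\<^sup>2 \<Longrightarrow> g x = 0"
proof
  define u where "u x = (x\<^sup>2 - T\<^sup>2) / \<delta>" for x
  define g where "g x = 1 - smoothstep (u x)" for x
  define g' where "g' x = - smoothstep' (u x) * (2 * x / \<delta>)" for x
  define g'' where "g'' x = - smoothstep'' (u x) * (2 * x / \<delta>) * (2 * x / \<delta>) - smoothstep' (u x) * (2 / \<delta>)" for x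
  define R where "R = sqrt (T\<^sup>2 + \<delta>)"
  have R: "0 \<le> R" using \<delta> by (simp add: R_def)
  have Du: "(u has_real_derivative 2 * x / \<delta>) (at x)" for x
    unfolding u_def[abs_def] using \<delta> by (auto intro!: derivative_eq_intros)
  have supp: "T \<le> \<bar>x\<bar> \<and> \<bar>x\<bar> \<le> R" if "0 \<le> u x" "u x \<le> 1" for x
  proof -
    have "T\<^sup>2 \<le> x\<^sup>2" "x\<^sup>2 \<le> T\<^sup>2 + \<delta>" using that \<delta> by (auto simp: u_def field_simps)
    then show ?thesis using T real_le_rsqrt[of "\<bar>x\<bar>" "T\<^sup>2 + \<delta>"] power2_le_imp_le[of T "\<bar>x\<bar>"]
      by (auto simp: R_def)
  qed
  have x_le: "\<bar>2 * x / \<delta>\<bar> \<le> 2 * R / \<delta>" if "0 \<le> u x" "u x \<le> 1" for x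
    using supp[OF that] \<delta> by (simp add: divide_right_mono abs_mult)
  have R': "0 \<le> 2 * R / \<delta>" using R \<delta> by simp
  show "cutoff g g' g'' T (4 * sqrt (T\<^sup>2 + \<delta>) / \<delta>) (15 * (2 * R / \<delta>) * (2 * R / \<delta>) + 2 * (2 / \<delta>))"
  proof
    fix x
    show "(g has_real_derivative g' x) (at x)"
      unfolding g_def[abs_def] g'_def
      by (auto intro!: derivative_eq_intros DERIV_chain2[OF DERIV_smoothstep Du])
    show "(g' has_real_derivative g'' x) (at x)"
      unfolding g'_def[abs_def] g''_def
      by (rule derivative_eq_intros DERIV_chain2[OF DERIV_smoothstep' Du] refl | use \<delta> in \<open>simp add: field_simps\<close>)+
    have cu: "isCont u x" for x using Du by (rule DERIV_isCont)
    show "isCont g'' x"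
      unfolding g''_def[abs_def] using \<delta>
      by (auto intro!: continuous_intros isCont_o2[OF cu] isCont_smoothstep'' DERIV_isCont[OF DERIV_smoothstep'])
    show "0 \<le> g x" "g x \<le> 1" using smoothstep_range by (auto simp: g_def)
    show "\<bar>g' x\<bar> \<le> 4 * sqrt (T\<^sup>2 + \<delta>) / \<delta>"
    proof (cases "0 \<le> u x \<and> u x \<le> 1")
      case True
      then have "\<bar>smoothstep' (u x)\<bar> * \<bar>2 * x / \<delta>\<bar> \<le> 2 * (2 * R / \<delta>)"
        by (intro mult_mono abs_smoothstep_deriv_le x_le) auto
      then show ?thesis by (simp add: g'_def abs_mult R_def)
    qed (use smoothstep_deriv_support \<delta> in \<open>auto simp: g'_def\<close>)
    show "\<bar>g'' x\<bar> \<le> 15 * (2 * R / \<delta>) * (2 * R / \<delta>) + 2 * (2 / \<delta>)"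
    proof (cases "0 \<le> u x \<and> u x \<le> 1")
      case True
      then have 1: "\<bar>- smoothstep'' (u x) * (2 * x / \<delta>) * (2 * x / \<delta>)\<bar> \<le> 15 * (2 * R / \<delta>) * (2 * R / \<delta>)"
        unfolding abs_mult abs_minus using R'
        by (intro mult_mono abs_smoothstep_deriv_le x_le[unfolded abs_mult]) auto
      have 2: "\<bar>smoothstep' (u x) * (2 / \<delta>)\<bar> \<le> 2 * (2 / \<delta>)"
        unfolding abs_mult using \<delta> by (intro mult_mono abs_smoothstep_deriv_le) auto
      show ?thesis unfolding g''_def by (rule order_trans[OF abs_triangle_ineq4 add_mono[OF 1 2]])
    qed (use smoothstep_deriv_support \<delta> R in \<open>auto simp: g''_def\<close>)
    show "T \<le> \<bar>x\<bar>" if "g' x \<noteq> 0"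
      using that smoothstep_deriv_support[of "u x"] supp[of x] by (auto simp: g'_def)
  qed (rule T)
  show "g x = 1" if "\<bar>x\<bar> \<le> T" for x
  proof -
    have "x\<^sup>2 \<le> T\<^sup>2" using that T abs_le_square_iff[of x T] by simp
    then show ?thesis using \<delta> by (simp add: g_def u_def smoothstep_eq_0 divide_le_0_iff)
  qed
  show "g x = 0" if "T\<^sup>2 + \<delta> \<le> x\<^sup>2" for x
    using that \<delta> by (simp add: g_def u_def smoothstep_eq_1 le_divide_eq)
qed

section \<open>Decoupling on an enlarged index set\<close>

lemma inner_on_Plus:
  assumes "finite I" "finite G"
  shows "inner_on (I <+> G) (case_sum u v) \<xi> = inner_on I u (\<lambda>i. \<xi> (Inl i)) + inner_on G v (\<lambda>j. \<xi> (Inr j))"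
  unfolding inner_on_def by (simp add: sum.Plus[OF assms])

lemma distr_gauss_reindex:
  assumes "inj_on f I" "f \<in> I \<rightarrow> K"
  shows "distr (gauss K) (gauss I) (\<lambda>\<xi>. \<lambda>i\<in>I. \<xi> (f i)) = gauss I"
  unfolding gauss_def using assms by (intro distr_PiM_reindex) (auto intro: prob_space_normal_density)

lemma integral_gauss_reindex:
  fixes h :: "('i \<Rightarrow> real) \<Rightarrow> real"
  assumes f: "inj_on f I" "f \<in> I \<rightarrow> K" and [measurable]: "h \<in> borel_measurable (gauss I)"
  shows "(\<integral>\<xi>. h (\<lambda>i\<in>I. \<xi> (f i)) \<partial>gauss K) = (\<integral>\<xi>. h \<xi> \<partial>gauss I)"
proof -
  have "(\<lambda>\<xi>. \<lambda>i\<in>I. \<xi> (f i)) \<in> gauss K \<rightarrow>\<^sub>M gauss I"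
    unfolding gauss_def using f by (intro measurable_restrict measurable_component_singleton) auto
  then show ?thesis
    by (subst distr_gauss_reindex[OF f, symmetric]) (simp add: integral_distr)
qed

lemma inner_on_cong: "(\<And>i. i \<in> I \<Longrightarrow> u i = u' i) \<Longrightarrow> (\<And>i. i \<in> I \<Longrightarrow> v i = v' i) \<Longrightarrow> inner_on I u v = inner_on I u' v'"
  unfolding inner_on_def by (auto intro: sum.cong)

text \<open>A function of the squared threshold \<open>s\<close>, because the upper and the lower
  estimate start their cutoffs at the different squared levels T^2 and T^2 - \<delta>.\<close>

definition correlation_error :: "'i set \<Rightarrow> 'w set \<Rightarrow> ('w \<Rightarrow> 'i \<Rightarrow> real) \<Rightarrow> real \<Rightarrow> real" where
  "correlation_error I G \<phi> s = (\<Sum>i\<in>G. \<Sum>j\<in>G - {i}. \<bar>inner_on I (\<phi> i) (\<phi> j)\<bar> *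
     exp (- s / (1 + \<bar>inner_on I (\<phi> i) (\<phi> j)\<bar>)))"

text \<open>
  The independent coefficients are coordinates on an extra copy of \<open>G\<close>, adjoined to \<open>I\<close>.
\<close>

lemma (in cutoff) gauss_decoupling:
  fixes \<phi> :: "'w \<Rightarrow> 'i \<Rightarrow> real"
  assumes I: "finite I" and G: "finite G"
    and \<phi>: "\<And>w. w \<in> G \<Longrightarrow> inner_on I (\<phi> w) (\<phi> w) = 1"
  shows "\<bar>(\<integral>\<xi>. cutoff_prod I G \<phi> \<xi> \<partial>gauss I) - (\<integral>x. g x \<partial>std_normal) ^ card G\<bar>
    \<le> 2 * pi * L\<^sup>2 * correlation_error I G \<phi> (T\<^sup>2)"
proof -
  define K where "K = I <+> G"
  \<comment> \<open>The given vectors are extended by 0 to the new indices, and \<open>c w\<close>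
    is the coordinate vector of the new index w; the two families are therefore orthogonal.\<close>
  define a where "a w = case_sum (\<phi> w) (\<lambda>_::'w. 0)" for w
  define c where "c w = case_sum (\<lambda>_::'i. 0::real) (\<lambda>v. if v = w then 1 else 0)" for w :: 'w
  have K: "finite K" using I G by (simp add: K_def)
  have a: "inner_on K (a w) \<xi> = inner_on I (\<phi> w) (\<lambda>i. \<xi> (Inl i))" for w \<xi>
    unfolding K_def a_def inner_on_Plus[OF I G] by (simp add: inner_on_def)
  have c: "inner_on K (c w) \<xi> = \<xi> (Inr w)" if "w \<in> G" for w \<xi>
    unfolding K_def c_def inner_on_Plus[OF I G] using that G by (simp add: inner_on_def if_distrib[of "\<lambda>x. x * _"] cong: if_cong)
  have aa: "inner_on K (a v) (a w) = inner_on I (\<phi> v) (\<phi> w)" for v w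
    unfolding a by (simp add: a_def)
  have 1: "(\<integral>\<xi>. cutoff_prod K G a \<xi> \<partial>gauss K) = (\<integral>\<xi>. cutoff_prod I G \<phi> \<xi> \<partial>gauss I)"
  proof -
    have "cutoff_prod K G a \<xi> = cutoff_prod I G \<phi> (\<lambda>i\<in>I. \<xi> (Inl i))" for \<xi>
      unfolding cutoff_prod_def a by (simp cong: inner_on_cong)
    then show ?thesis
      by (simp, intro integral_gauss_reindex) (auto simp: K_def)
  qed
  have 2: "(\<integral>\<xi>. cutoff_prod K G c \<xi> \<partial>gauss K) = (\<integral>x. g x \<partial>std_normal) ^ card G"
  proof -
    have [measurable]: "(\<lambda>\<xi>. \<Prod>w\<in>G. g (\<xi> w)) \<in> borel_measurable (gauss G)"
      unfolding gauss_def by measurable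
    have "(\<integral>\<xi>. cutoff_prod K G c \<xi> \<partial>gauss K) = (\<integral>\<xi>. (\<Prod>w\<in>G. g ((\<lambda>w\<in>G. \<xi> (Inr w)) w)) \<partial>gauss K)"
      unfolding cutoff_prod_def by (simp add: c)
    also have "\<dots> = (\<integral>\<xi>. (\<Prod>w\<in>G. g (\<xi> w)) \<partial>gauss G)"
      by (rule integral_gauss_reindex) (auto simp: K_def)
    also have "\<dots> = (\<Prod>w\<in>G. \<integral>x. g x \<partial>std_normal)"
      unfolding gauss_def using g_range
      by (intro gauss_prod.product_integral_prod G std_normal.integrable_const_bound[where B=1]) auto
    finally show ?thesis by simp
  qed
  have "\<bar>(\<integral>\<xi>. cutoff_prod K G a \<xi> \<partial>gauss K) - (\<integral>\<xi>. cutoff_prod K G c \<xi> \<partial>gauss K)\<bar>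
      \<le> 2 * pi * L\<^sup>2 * (\<Sum>i\<in>G. \<Sum>j\<in>G - {i}. \<bar>inner_on K (a i) (a j)\<bar> * exp (- T\<^sup>2 / (1 + \<bar>inner_on K (a i) (a j)\<bar>)))"
    by (rule gauss_comparison[OF K G])
      (simp_all add: aa \<phi> c, simp_all add: c_def a_def inner_on_commute[of K "case_sum (\<phi> _) _"] c[unfolded c_def])
  then show ?thesis
    unfolding 1 2 aa correlation_error_def .
qed

section \<open>Maxima of correlated Gaussians and the normal tail\<close>

text \<open>The chi-square distribution function with one degree of freedom; with the squared level
  as argument, the shifts by \<delta> are additive.\<close>

definition sq_cdf :: "real \<Rightarrow> real" where
  "sq_cdf s = measure std_normal {x. x\<^sup>2 \<le> s}"

lemma sq_cdf_range: "0 \<le> sq_cdf s" "sq_cdf s \<le> 1"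
  unfolding sq_cdf_def by (auto intro: std_normal.prob_le_1)

lemma inner_on_self_eq_L2: "inner_on I u u = (L2_set u I)\<^sup>2"
  by (simp add: inner_on_def L2_set_def sum_nonneg power2_eq_square)

text \<open>The cutoff starting at T dominates the event, and each independent factor is dominated
  by the indicator of x^2 \<le> T^2 + \<delta>. The constant is 32 pi = 2 pi * 4^2, with the 4 from
  the slope.\<close>

lemma gauss_max_upper:
  fixes \<phi> :: "'w \<Rightarrow> 'i \<Rightarrow> real"
  assumes I: "finite I" and G: "finite G"
    and \<phi>: "\<And>w. w \<in> G \<Longrightarrow> inner_on I (\<phi> w) (\<phi> w) = 1" and T: "0 \<le> T" and \<delta>: "0 < \<delta>"
  shows "measure (gauss I) {\<xi>\<in>space (gauss I). \<forall>w\<in>G. \<bar>inner_on I (\<phi> w) \<xi>\<bar> \<le> T}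
    \<le> sq_cdf (T\<^sup>2 + \<delta>) ^ card G + 32 * pi * (T\<^sup>2 + \<delta>) / \<delta>\<^sup>2 * correlation_error I G \<phi> (T\<^sup>2)"
proof -
  interpret P: prob_space "gauss I" by (rule prob_space_gauss)
  obtain g g' g'' C where "cutoff g g' g'' T (4 * sqrt (T\<^sup>2 + \<delta>) / \<delta>) C"
    and g1: "\<And>x. \<bar>x\<bar> \<le> T \<Longrightarrow> g x = 1" and g0: "\<And>x. T\<^sup>2 + \<delta> \<le> x\<^sup>2 \<Longrightarrow> g x = 0"
    using cutoff_exists[OF T \<delta>] by blast
  then interpret cutoff g g' g'' T "4 * sqrt (T\<^sup>2 + \<delta>) / \<delta>" C by simp
  define E where "E = {\<xi>\<in>space (gauss I). \<forall>w\<in>G. \<bar>inner_on I (\<phi> w) \<xi>\<bar> \<le> T}"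
  have [measurable]: "E \<in> sets (gauss I)" unfolding E_def using G by measurable
  have "measure (gauss I) E = (\<integral>\<xi>. indicator E \<xi> \<partial>gauss I)" by simp
  also have "\<dots> \<le> (\<integral>\<xi>. cutoff_prod I G \<phi> \<xi> \<partial>gauss I)"
  proof (rule integral_mono)
    show "integrable (gauss I) (cutoff_prod I G \<phi>)"
      by (rule P.integrable_const_bound[where B=1]) (auto simp: abs_cutoff_prod)
    show "integrable (gauss I) (indicat_real E)" by (simp add: P.emeasure_eq_measure)
    show "indicator E \<xi> \<le> cutoff_prod I G \<phi> \<xi>" for \<xi>
      using g_range g1 by (auto simp: E_def cutoff_prod_def indicator_def intro!: prod_nonneg prod_ge_1)
  qed
  also have "\<dots> \<le> (\<integral>x. g x \<partial>std_normal) ^ card G + 2 * pi * (4 * sqrt (T\<^sup>2 + \<delta>) / \<delta>)\<^sup>2 * correlation_error I G \<phi> (T\<^sup>2)"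
    using gauss_decoupling[OF I G, of \<phi>] \<phi> by simp
  also have "(\<integral>x. g x \<partial>std_normal) ^ card G \<le> sq_cdf (T\<^sup>2 + \<delta>) ^ card G"
  proof (rule power_mono)
    have "(\<integral>x. g x \<partial>std_normal) \<le> (\<integral>x. indicator {x. x\<^sup>2 \<le> T\<^sup>2 + \<delta>} x \<partial>std_normal)"
    proof (rule integral_mono)
      show "integrable std_normal g"
        using g_range by (intro std_normal.integrable_const_bound[where B=1]) auto
      show "integrable std_normal (indicat_real {x. x\<^sup>2 \<le> T\<^sup>2 + \<delta>})"
        by (simp add: std_normal.emeasure_eq_measure)
      show "g x \<le> indicator {x. x\<^sup>2 \<le> T\<^sup>2 + \<delta>} x" for x
        using g_range g0[of x] by (auto simp: indicator_def)
    qed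
    then show "(\<integral>x. g x \<partial>std_normal) \<le> sq_cdf (T\<^sup>2 + \<delta>)" by (simp add: sq_cdf_def)
    show "0 \<le> (\<integral>x. g x \<partial>std_normal)" using g_range by simp
  qed
  also have "2 * pi * (4 * sqrt (T\<^sup>2 + \<delta>) / \<delta>)\<^sup>2 = 32 * pi * (T\<^sup>2 + \<delta>) / \<delta>\<^sup>2"
    using \<delta> by (simp add: power_divide power_mult_distrib)
  finally show ?thesis unfolding E_def by simp
qed

text \<open>The cutoff is moved inwards, so that it has already reached 0 at T and its product lies
  below the indicator of the event. The joint tails are then those at the smaller squared level T^2
  - \<delta>.\<close>

lemma gauss_max_lower:
  fixes \<phi> :: "'w \<Rightarrow> 'i \<Rightarrow> real"
  assumes I: "finite I" and G: "finite G"
    and \<phi>: "\<And>w. w \<in> G \<Longrightarrow> inner_on I (\<phi> w) (\<phi> w) = 1" and T: "0 \<le> T" and \<delta>: "0 < \<delta>" "\<delta> \<le> T\<^sup>2"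
  shows "sq_cdf (T\<^sup>2 - \<delta>) ^ card G - 32 * pi * T\<^sup>2 / \<delta>\<^sup>2 * correlation_error I G \<phi> (T\<^sup>2 - \<delta>)
    \<le> measure (gauss I) {\<xi>\<in>space (gauss I). \<forall>w\<in>G. \<bar>inner_on I (\<phi> w) \<xi>\<bar> \<le> T}"
proof -
  interpret P: prob_space "gauss I" by (rule prob_space_gauss)
  define S where "S = sqrt (T\<^sup>2 - \<delta>)"
  have S: "0 \<le> S" "S\<^sup>2 = T\<^sup>2 - \<delta>" using \<delta> by (auto simp: S_def)
  obtain g g' g'' C where "cutoff g g' g'' S (4 * sqrt (S\<^sup>2 + \<delta>) / \<delta>) C"
    and g1: "\<And>x. \<bar>x\<bar> \<le> S \<Longrightarrow> g x = 1" and g0: "\<And>x. S\<^sup>2 + \<delta> \<le> x\<^sup>2 \<Longrightarrow> g x = 0"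
    using cutoff_exists[OF S(1) \<delta>(1)] by blast
  then interpret cutoff g g' g'' S "4 * sqrt (S\<^sup>2 + \<delta>) / \<delta>" C by simp
  define E where "E = {\<xi>\<in>space (gauss I). \<forall>w\<in>G. \<bar>inner_on I (\<phi> w) \<xi>\<bar> \<le> T}"
  have [measurable]: "E \<in> sets (gauss I)" unfolding E_def using G by measurable
  have "2 * pi * (4 * sqrt (S\<^sup>2 + \<delta>) / \<delta>)\<^sup>2 = 32 * pi * T\<^sup>2 / \<delta>\<^sup>2"
    using \<delta> T by (simp add: power_divide power_mult_distrib S)
  then have "(\<integral>x. g x \<partial>std_normal) ^ card G - 32 * pi * T\<^sup>2 / \<delta>\<^sup>2 * correlation_error I G \<phi> (T\<^sup>2 - \<delta>)
      \<le> (\<integral>\<xi>. cutoff_prod I G \<phi> \<xi> \<partial>gauss I)"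
    using gauss_decoupling[OF I G, of \<phi>] \<phi> unfolding S by simp
  also have "\<dots> \<le> (\<integral>\<xi>. indicator E \<xi> \<partial>gauss I)"
  proof (rule integral_mono)
    show "integrable (gauss I) (cutoff_prod I G \<phi>)"
      by (rule P.integrable_const_bound[where B=1]) (auto simp: abs_cutoff_prod)
    show "integrable (gauss I) (indicat_real E)" by (simp add: P.emeasure_eq_measure)
    show "cutoff_prod I G \<phi> \<xi> \<le> indicator E \<xi>" if \<xi>: "\<xi> \<in> space (gauss I)" for \<xi>
    proof (cases "\<xi> \<in> E")
      case False
      then obtain w where w: "w \<in> G" "T < \<bar>inner_on I (\<phi> w) \<xi>\<bar>" using \<xi> by (auto simp: E_def not_le)
      then have "T\<^sup>2 \<le> (inner_on I (\<phi> w) \<xi>)\<^sup>2" using T abs_le_square_iff[of T "inner_on I (\<phi> w) \<xi>"] by simp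
      then have "g (inner_on I (\<phi> w) \<xi>) = 0" using g0 S by simp
      then have "cutoff_prod I G \<phi> \<xi> = 0" unfolding cutoff_prod_def using w by (intro prod_zero G) auto
      then show ?thesis by simp
    qed (use abs_cutoff_prod[of I G \<phi> \<xi>] in auto)
  qed
  also have "\<dots> = measure (gauss I) E" by simp
  finally have *: "(\<integral>x. g x \<partial>std_normal) ^ card G - 32 * pi * T\<^sup>2 / \<delta>\<^sup>2 * correlation_error I G \<phi> (T\<^sup>2 - \<delta>)
      \<le> measure (gauss I) E" .
  have "sq_cdf (T\<^sup>2 - \<delta>) ^ card G \<le> (\<integral>x. g x \<partial>std_normal) ^ card G"
  proof (rule power_mono[OF _ sq_cdf_range(1)])
    have "(\<integral>x. indicator {x. x\<^sup>2 \<le> T\<^sup>2 - \<delta>} x \<partial>std_normal) \<le> (\<integral>x. g x \<partial>std_normal)"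
    proof (rule integral_mono)
      show "integrable std_normal g"
        using g_range by (intro std_normal.integrable_const_bound[where B=1]) auto
      show "integrable std_normal (indicat_real {x. x\<^sup>2 \<le> T\<^sup>2 - \<delta>})"
        by (simp add: std_normal.emeasure_eq_measure)
      show "indicator {x. x\<^sup>2 \<le> T\<^sup>2 - \<delta>} x \<le> g x" for x
        using g_range g1[of x] abs_le_square_iff[of x S] S by (auto simp: indicator_def)
    qed
    then show "sq_cdf (T\<^sup>2 - \<delta>) \<le> (\<integral>x. g x \<partial>std_normal)" by (simp add: sq_cdf_def)
  qed
  with * show ?thesis unfolding E_def by linarith
qed

text \<open>A union bound over \<open>B\<close>: what the event for \<open>G\<close> loses by adding
  \<open>B\<close> is covered by the tail events of the elements of \<open>B\<close>.\<close>

lemma gauss_max_remove: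
  fixes \<phi> :: "'w \<Rightarrow> 'i \<Rightarrow> real"
  assumes I: "finite I" and G: "finite G" "finite B"
    and \<phi>: "\<And>w. w \<in> B \<Longrightarrow> inner_on I (\<phi> w) (\<phi> w) = 1" and T: "0 \<le> T"
  shows "measure (gauss I) {\<xi>\<in>space (gauss I). \<forall>w\<in>G. \<bar>inner_on I (\<phi> w) \<xi>\<bar> \<le> T} - 2 * real (card B) * exp (- T\<^sup>2 / 2)
    \<le> measure (gauss I) {\<xi>\<in>space (gauss I). \<forall>w\<in>G \<union> B. \<bar>inner_on I (\<phi> w) \<xi>\<bar> \<le> T}"
proof -
  interpret P: prob_space "gauss I" by (rule prob_space_gauss)
  define E where "E A = {\<xi>\<in>space (gauss I). \<forall>w\<in>A. \<bar>inner_on I (\<phi> w) \<xi>\<bar> \<le> T}" for A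
  define X where "X w = {\<xi>\<in>space (gauss I). T \<le> \<bar>inner_on I (\<phi> w) \<xi>\<bar>}" for w
  have [measurable]: "E A \<in> sets (gauss I)" if "finite A" for A unfolding E_def using that by measurable
  have [measurable]: "X w \<in> sets (gauss I)" for w unfolding X_def by measurable
  have "measure (gauss I) (E G) \<le> measure (gauss I) (E (G \<union> B) \<union> (\<Union>w\<in>B. X w))"
  proof (rule P.finite_measure_mono)
    show "E G \<subseteq> E (G \<union> B) \<union> (\<Union>w\<in>B. X w)" by (auto simp: E_def X_def)
    show "E (G \<union> B) \<union> (\<Union>w\<in>B. X w) \<in> sets (gauss I)" using G by (intro sets.Un sets.finite_UN) auto
  qed
  also have "\<dots> \<le> measure (gauss I) (E (G \<union> B)) + measure (gauss I) (\<Union>w\<in>B. X w)"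
    using G by (intro measure_Un_le) auto
  also have "measure (gauss I) (\<Union>w\<in>B. X w) \<le> (\<Sum>w\<in>B. measure (gauss I) (X w))"
    using G by (intro measure_UNION_le) auto
  also have "\<dots> \<le> (\<Sum>w\<in>B. 2 * exp (- T\<^sup>2 / 2))"
    unfolding X_def by (intro sum_mono gauss_abs_tail I \<phi> T)
  finally show ?thesis unfolding E_def by simp
qed

text \<open>Mills ratio: - \<phi>(x) / x is an antiderivative of \<phi>(x) (1 + 1 / x^2) for the
  normal density \<phi>, and on [t, \<infinity>) the bracket lies between 1 and 1 + 1 / t^2.\<close>

lemma std_normal_atLeast_bounds:
  assumes t: "0 < t"
  shows "measure std_normal {t..} \<le> std_normal_density t / t"
    and "std_normal_density t / t \<le> (1 + 1 / t\<^sup>2) * measure std_normal {t..}"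
proof -
  have A: "ennreal (measure std_normal {t..}) = (\<integral>\<^sup>+x. ennreal (std_normal_density x * indicator {t..} x) \<partial>lborel)"
    unfolding std_normal.emeasure_eq_measure[symmetric]
    by (subst emeasure_density) (auto intro!: nn_integral_cong simp: indicator_def)
  have F: "(\<integral>\<^sup>+x. ennreal (std_normal_density x * (1 + 1 / x\<^sup>2)) * indicator {t..} x \<partial>lborel)
      = ennreal (0 - (- std_normal_density t / t))"
  proof (rule nn_integral_FTC_atLeast)
    show "((\<lambda>x. - std_normal_density x / x) has_real_derivative std_normal_density x * (1 + 1 / x\<^sup>2)) (at x)"
      if "t \<le> x" for x
      using that t by (auto intro!: derivative_eq_intros simp: field_simps power2_eq_square)
    show "((\<lambda>x. - std_normal_density x / x) \<longlongrightarrow> 0) at_top"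
      unfolding std_normal_density_def by real_asymp
  qed auto
  have "(\<integral>\<^sup>+x. ennreal (std_normal_density x * indicator {t..} x) \<partial>lborel)
      \<le> (\<integral>\<^sup>+x. ennreal (std_normal_density x * (1 + 1 / x\<^sup>2)) * indicator {t..} x \<partial>lborel)"
  proof (rule nn_integral_mono)
    fix x
    have "std_normal_density x * 1 \<le> std_normal_density x * (1 + 1 / x\<^sup>2)"
      by (intro mult_left_mono) auto
    then show "ennreal (std_normal_density x * indicator {t..} x)
        \<le> ennreal (std_normal_density x * (1 + 1 / x\<^sup>2)) * indicator {t..} x"
      by (auto simp: indicator_def intro!: ennreal_leI)
  qed
  then have "ennreal (measure std_normal {t..}) \<le> ennreal (std_normal_density t / t)"
    unfolding A F by simp
  then show "measure std_normal {t..} \<le> std_normal_density t / t"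
    using t by (simp add: ennreal_le_iff)
  have "ennreal (std_normal_density t / t) \<le> ennreal (1 + 1 / t\<^sup>2) * ennreal (measure std_normal {t..})"
  proof -
    have "(\<integral>\<^sup>+x. ennreal (std_normal_density x * (1 + 1 / x\<^sup>2)) * indicator {t..} x \<partial>lborel)
        \<le> (\<integral>\<^sup>+x. ennreal (1 + 1 / t\<^sup>2) * ennreal (std_normal_density x * indicator {t..} x) \<partial>lborel)"
    proof (rule nn_integral_mono)
      fix x
      have "std_normal_density x * (1 + 1 / x\<^sup>2) \<le> std_normal_density x * (1 + 1 / t\<^sup>2)" if "t \<le> x"
        using that t by (intro mult_left_mono add_left_mono divide_left_mono power_mono mult_pos_pos) auto
      then show "ennreal (std_normal_density x * (1 + 1 / x\<^sup>2)) * indicator {t..} x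
          \<le> ennreal (1 + 1 / t\<^sup>2) * ennreal (std_normal_density x * indicator {t..} x)"
        by (subst ennreal_mult'[symmetric]) (auto simp: indicator_def mult.commute simp del: ennreal_plus intro!: ennreal_leI)
    qed
    also have "\<dots> = ennreal (1 + 1 / t\<^sup>2) * ennreal (measure std_normal {t..})"
      unfolding A by (rule nn_integral_cmult) auto
    finally show ?thesis using F by simp
  qed
  then show "std_normal_density t / t \<le> (1 + 1 / t\<^sup>2) * measure std_normal {t..}"
    using t by (subst (asm) ennreal_mult'[symmetric]) (auto simp: ennreal_le_iff)
qed

text \<open>The normal law is symmetric and has no atoms, so both strict tails equal the closed
  upper one.\<close>

lemma one_minus_sq_cdf:
  assumes t: "0 < t"
  shows "1 - sq_cdf (t\<^sup>2) = 2 * measure std_normal {t..}"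
proof -
  have null: "measure std_normal {t} = 0" for t
    by (simp add: measure_def emeasure_density nn_integral_indicator_singleton)
  have refl: "emeasure std_normal {..-t} = emeasure std_normal {t..}"
  proof -
    have "emeasure std_normal {..-t} = (\<integral>\<^sup>+x. ennreal (std_normal_density x) * indicator {..-t} x \<partial>lborel)"
      by (subst emeasure_density) auto
    also have "\<dots> = ennreal \<bar>-1\<bar> * (\<integral>\<^sup>+x. ennreal (std_normal_density (0 + -1 * x)) * indicator {..-t} (0 + -1 * x) \<partial>lborel)"
      by (rule nn_integral_real_affine) auto
    also have "\<dots> = emeasure std_normal {t..}"
      by (subst emeasure_density) (auto intro!: nn_integral_cong simp: indicator_def normal_density_def)
    finally show ?thesis .
  qed
  have "{x. x\<^sup>2 \<le> t\<^sup>2} = UNIV - ({..<-t} \<union> {t<..})"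
    unfolding abs_le_square_iff[symmetric] using t by auto
  then have "sq_cdf (t\<^sup>2) = 1 - measure std_normal ({..<-t} \<union> {t<..})"
    unfolding sq_cdf_def using std_normal.prob_compl[of "{..<-t} \<union> {t<..}"] by simp
  also have "measure std_normal ({..<-t} \<union> {t<..}) = measure std_normal {..<-t} + measure std_normal {t<..}"
    using t by (intro std_normal.finite_measure_Union) auto
  also have "measure std_normal {..<-t} = measure std_normal {..-t}"
    using std_normal.finite_measure_Union[of "{..<-t}" "{-t}"] null[of "-t"]
    by (simp add: ivl_disj_un_singleton del: Un_insert_right Un_empty_right)
  also have "measure std_normal {..-t} = measure std_normal {t..}"
    using refl by (simp add: measure_def)
  also have "measure std_normal {t<..} = measure std_normal {t..}"
    using std_normal.finite_measure_Union[of "{t<..}" "{t}"] null[of t]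
    by (simp add: ivl_disj_un_singleton Un_commute[of _ "{t}"] del: Un_insert_right Un_empty_right Un_insert_left Un_empty_left)
  finally show ?thesis by simp
qed

section \<open>Asymptotics at the extreme value level\<close>

text \<open>The squared threshold for \<sigma> = 1 up to o(1). The term 2 z converts a shift
  \<delta> of the squared level into a shift \<delta> / 2 of z.\<close>

definition ev_level :: "real \<Rightarrow> nat \<Rightarrow> real" where
  "ev_level z m = 2 * ln (real m) - ln (ln (real m)) - ln pi + 2 * z"

text \<open>In the square of r + c / (2 r), with r^2 = 2 log m, the cross term is exactly c. The
  rest is c^2 / (8 log m), and c grows only like log log m.\<close>

lemma ev_threshold_sq:
  "(\<lambda>m. (ev_threshold 1 \<alpha> m)\<^sup>2 - ev_level (gumbel_quantile \<alpha>) m) \<longlonglongrightarrow> 0"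
proof -
  define K where "K = 2 * gumbel_quantile \<alpha> - ln pi"
  have "(\<lambda>m::nat. (K - ln (ln (real m)))\<^sup>2 / (8 * ln (real m))) \<longlonglongrightarrow> 0"
    by real_asymp
  moreover have "\<forall>\<^sub>F m::nat in sequentially. 0 < ln (real m)"
    by real_asymp
  then have "\<forall>\<^sub>F m::nat in sequentially. (K - ln (ln (real m)))\<^sup>2 / (8 * ln (real m))
      = (ev_threshold 1 \<alpha> m)\<^sup>2 - ev_level (gumbel_quantile \<alpha>) m"
  proof eventually_elim
    case (elim m)
    define r where "r = sqrt (2 * ln (real m))"
    have r: "r\<^sup>2 = 2 * ln (real m)" "r > 0" using elim by (auto simp: r_def)
    define c where "c = K - ln (ln (real m))"
    have "(r + c / (2 * r))\<^sup>2 = r\<^sup>2 + c + c\<^sup>2 / (4 * r\<^sup>2)"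
      using r(2) by (simp add: power2_eq_square field_simps)
    moreover have "ev_threshold 1 \<alpha> m = r + c / (2 * r)"
      by (simp add: ev_threshold_def r_def c_def K_def algebra_simps)
    moreover have "ev_level (gumbel_quantile \<alpha>) m = r\<^sup>2 + c"
      by (simp add: ev_level_def r c_def K_def)
    ultimately show ?case by (simp add: r(1) c_def)
  qed
  ultimately show ?thesis by (rule Lim_transform_eventually)
qed

lemma ev_threshold_at_top: "filterlim (ev_threshold 1 \<alpha>) at_top at_top"
  unfolding ev_threshold_def by real_asymp

lemma ev_level_div_ln: "(\<lambda>m. ev_level z m / ln (real m)) \<longlonglongrightarrow> 2"
  unfolding ev_level_def by real_asymp

context
  fixes m :: "nat \<Rightarrow> nat" and s :: "nat \<Rightarrow> real" and z :: real
  assumes m: "filterlim m at_top at_top" and s: "(\<lambda>n. s n - ev_level z (m n)) \<longlonglongrightarrow> 0"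
begin

lemma filterlim_ln_m: "filterlim (\<lambda>n. ln (real (m n))) at_top at_top"
  by (rule filterlim_compose[OF ln_at_top filterlim_compose[OF filterlim_real_sequentially m]])

lemma level_div_ln: "(\<lambda>n. s n / ln (real (m n))) \<longlonglongrightarrow> 2"
proof -
  have "(\<lambda>n. (s n - ev_level z (m n)) / ln (real (m n)) + ev_level z (m n) / ln (real (m n))) \<longlonglongrightarrow> 0 + 2"
  proof (rule tendsto_add)
    show "(\<lambda>n. (s n - ev_level z (m n)) / ln (real (m n))) \<longlonglongrightarrow> 0"
      by (rule real_tendsto_divide_at_top[OF s filterlim_ln_m])
    show "(\<lambda>n. ev_level z (m n) / ln (real (m n))) \<longlonglongrightarrow> 2"
      by (rule filterlim_compose[OF ev_level_div_ln m])
  qed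
  then show ?thesis by (simp add: add_divide_distrib[symmetric])
qed

lemma level_at_top: "filterlim s at_top at_top"
proof -
  have "filterlim (\<lambda>n. s n / ln (real (m n)) * ln (real (m n))) at_top at_top"
    by (rule filterlim_tendsto_pos_mult_at_top[OF level_div_ln _ filterlim_ln_m]) simp
  moreover have ev: "\<forall>\<^sub>F n in sequentially. s n / ln (real (m n)) * ln (real (m n)) = s n"
    using eventually_gt_at_top[of 0, THEN filterlim_ln_m[unfolded filterlim_iff, rule_format]]
    by eventually_elim simp
  ultimately show ?thesis by (simp only: filterlim_cong[OF refl refl ev])
qed

text \<open>This identity explains the corrections in the threshold: log log m and log pi leave sqrt
  (pi log m), which the denominator of the Mills ratio cancels. It also measures the tail of the
  discarded elements.\<close>

lemma exp_level:
  "\<forall>\<^sub>F n in sequentially. real (m n) * exp (- s n / 2)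
     = sqrt (pi * ln (real (m n))) * exp (- z - (s n - ev_level z (m n)) / 2)"
  using eventually_gt_at_top[of 0, THEN filterlim_ln_m[unfolded filterlim_iff, rule_format]]
proof eventually_elim
  case (elim n)
  define l where "l = ln (real (m n))"
  have l: "0 < l" using elim by (simp add: l_def)
  have "real (m n) > 0" using elim by (cases "m n") auto
  then have mn: "real (m n) = exp l" by (simp add: l_def)
  have "real (m n) * exp (- s n / 2) = exp (l - s n / 2)"
    by (simp add: mn mult_exp_exp)
  also have "l - s n / 2 = (ln pi + ln l) / 2 + (- z - (s n - ev_level z (m n)) / 2)"
    by (simp add: ev_level_def l_def field_simps)
  also have "exp \<dots> = sqrt (pi * l) * exp (- z - (s n - ev_level z (m n)) / 2)"
  proof -
    have "exp (ln (sqrt (pi * l))) = sqrt (pi * l)" using l by (intro exp_ln) auto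
    then show ?thesis unfolding exp_add using l by (simp add: ln_sqrt ln_mult)
  qed
  finally show ?case by (simp add: l_def)
qed

text \<open>\<open>D\<close> is m times the leading Mills term of both tails. It equals sqrt (2 log
  m / s) exp (- z) up to a factor tending to 1, and s is asymptotic to 2 log m. The relative error
  of the Mills bounds is 1 / s.\<close>

lemma tail_limit: "(\<lambda>n. real (m n) * (1 - sq_cdf (s n))) \<longlonglongrightarrow> exp (- z)"
proof -
  define D where "D n = real (m n) * (2 * (std_normal_density (sqrt (s n)) / sqrt (s n)))" for n
  have pos: "\<forall>\<^sub>F n in sequentially. 0 < s n"
    using level_at_top by (auto simp: filterlim_at_top_dense)
  have pos_l: "\<forall>\<^sub>F n in sequentially. 0 < ln (real (m n))"
    using filterlim_ln_m by (auto simp: filterlim_at_top_dense)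
  have D: "D \<longlonglongrightarrow> exp (- z)"
  proof -
    have "(\<lambda>n. sqrt 2 * (1 / sqrt (s n / ln (real (m n)))) * exp (- z - (s n - ev_level z (m n)) / 2))
        \<longlonglongrightarrow> sqrt 2 * (1 / sqrt 2) * exp (- z - 0 / 2)"
      by (intro tendsto_intros level_div_ln s) auto
    then have lim: "(\<lambda>n. sqrt 2 * (1 / sqrt (s n / ln (real (m n)))) * exp (- z - (s n - ev_level z (m n)) / 2))
        \<longlonglongrightarrow> exp (- z)" by simp
    have "\<forall>\<^sub>F n in sequentially. sqrt 2 * (1 / sqrt (s n / ln (real (m n)))) * exp (- z - (s n - ev_level z (m n)) / 2) = D n"
      using pos pos_l exp_level
    proof eventually_elim
      case (elim n)
      have "D n = 2 / (sqrt (2 * pi) * sqrt (s n)) * (real (m n) * exp (- s n / 2))"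
        using elim(1) by (simp add: D_def std_normal_density_def)
      also have "\<dots> = 2 / (sqrt (2 * pi) * sqrt (s n)) * (sqrt (pi * ln (real (m n))) * exp (- z - (s n - ev_level z (m n)) / 2))"
        by (simp only: elim(3))
      also have "\<dots> = sqrt 2 * (1 / sqrt (s n / ln (real (m n)))) * exp (- z - (s n - ev_level z (m n)) / 2)"
      proof -
        have "2 / (sqrt (2 * pi) * sqrt (s n)) * sqrt (pi * ln (real (m n))) = (2 / sqrt 2) * (sqrt (ln (real (m n))) / sqrt (s n))"
          by (simp add: real_sqrt_mult)
        also have "\<dots> = sqrt 2 * (1 / sqrt (s n / ln (real (m n))))"
          by (simp add: real_div_sqrt real_sqrt_divide)
        finally show ?thesis by (simp only: mult.assoc[symmetric])
      qed
      finally show ?case by simp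
    qed
    then show ?thesis by (rule Lim_transform_eventually[OF lim])
  qed
  have low: "(\<lambda>n. D n / (1 + 1 / s n)) \<longlonglongrightarrow> exp (- z)"
  proof -
    have "(\<lambda>n. 1 / s n) \<longlonglongrightarrow> 0"
      by (rule tendsto_divide_0[OF tendsto_const filterlim_at_top_imp_at_infinity[OF level_at_top]])
    then have "(\<lambda>n. D n / (1 + 1 / s n)) \<longlonglongrightarrow> exp (- z) / (1 + 0)"
      by (intro tendsto_intros D) auto
    then show ?thesis by simp
  qed
  have bounds: "\<forall>\<^sub>F n in sequentially. D n / (1 + 1 / s n) \<le> real (m n) * (1 - sq_cdf (s n))
      \<and> real (m n) * (1 - sq_cdf (s n)) \<le> D n"
    using pos
  proof eventually_elim
    case (elim n)
    define t where "t = sqrt (s n)"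
    have t: "0 < t" "s n = t\<^sup>2" using elim by (auto simp: t_def)
    define A where "A = measure std_normal {t..}"
    have A: "1 - sq_cdf (s n) = 2 * A" using one_minus_sq_cdf[OF t(1)] by (simp add: t(2) A_def)
    define f where "f = std_normal_density t / t"
    have f: "A \<le> f" "f \<le> (1 + 1 / s n) * A"
      using std_normal_atLeast_bounds[OF t(1)] by (simp_all add: A_def f_def t(2))
    then have "f / (1 + 1 / s n) \<le> A" using elim by (simp add: divide_le_eq add_pos_pos mult.commute)
    then have "real (m n) * 2 * (f / (1 + 1 / s n)) \<le> real (m n) * 2 * A"
      by (intro mult_left_mono) auto
    moreover have "real (m n) * 2 * A \<le> real (m n) * 2 * f"
      using f by (intro mult_left_mono) auto
    ultimately show ?case
      unfolding A D_def t_def[symmetric] f_def[symmetric] by (simp add: mult.assoc)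
  qed
  show ?thesis
    by (rule tendsto_sandwich[OF _ _ low D]) (use bounds in \<open>auto elim: eventually_mono\<close>)
qed

end

text \<open>Poisson limit from - q - 2 q^2 \<le> ln (1 - q) \<le> - q for q < 1/2: the quadratic
  term contributes 2 (N q) q, which tends to 0.\<close>

lemma power_one_minus_tendsto:
  fixes q :: "nat \<Rightarrow> real" and N :: "nat \<Rightarrow> nat"
  assumes q: "\<And>n. 0 \<le> q n" "q \<longlonglongrightarrow> 0" and N: "(\<lambda>n. real (N n) * q n) \<longlonglongrightarrow> \<tau>"
  shows "(\<lambda>n. (1 - q n) ^ N n) \<longlonglongrightarrow> exp (- \<tau>)"
proof (rule tendsto_sandwich)
  have small: "\<forall>\<^sub>F n in sequentially. q n < 1 / 2"
    using order_tendstoD(2)[OF q(2), of "1/2"] by simp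
  have pow: "(1 - q n) ^ N n = exp (real (N n) * ln (1 - q n))" if "q n < 1 / 2" for n
    using that by (simp add: exp_of_nat_mult)
  show "\<forall>\<^sub>F n in sequentially. exp (- (real (N n) * q n) - 2 * (real (N n) * q n) * q n) \<le> (1 - q n) ^ N n"
    using small
  proof eventually_elim
    case (elim n)
    have "- q n - 2 * (q n)\<^sup>2 \<le> ln (1 - q n)"
      using elim q(1)[of n] by (intro ln_one_minus_pos_lower_bound) auto
    then have "real (N n) * (- q n - 2 * (q n)\<^sup>2) \<le> real (N n) * ln (1 - q n)"
      by (intro mult_left_mono) auto
    then show ?case using elim by (simp add: pow power2_eq_square algebra_simps)
  qed
  show "\<forall>\<^sub>F n in sequentially. (1 - q n) ^ N n \<le> exp (- (real (N n) * q n))"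
    using small
  proof eventually_elim
    case (elim n)
    have "ln (1 - q n) \<le> - q n"
      using ln_le_minus_one[of "1 - q n"] elim by simp
    then have "real (N n) * ln (1 - q n) \<le> real (N n) * (- q n)"
      by (intro mult_left_mono) auto
    then show ?case using elim by (simp add: pow)
  qed
  show "(\<lambda>n. exp (- (real (N n) * q n))) \<longlonglongrightarrow> exp (- \<tau>)"
    by (intro tendsto_intros N)
  have "(\<lambda>n. exp (- (real (N n) * q n) - 2 * (real (N n) * q n) * q n)) \<longlonglongrightarrow> exp (- \<tau> - 2 * \<tau> * 0)"
    by (intro tendsto_intros N q)
  then show "(\<lambda>n. exp (- (real (N n) * q n) - 2 * (real (N n) * q n) * q n)) \<longlonglongrightarrow> exp (- \<tau>)"
    by simp
qed

text \<open>The exponent \<open>N\<close> may differ from \<open>m\<close>, since the independent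
  model only keeps the elements that were not discarded.\<close>

lemma sq_cdf_power_limit:
  fixes m N :: "nat \<Rightarrow> nat"
  assumes m: "filterlim m at_top at_top" and s: "(\<lambda>n. s n - ev_level z (m n)) \<longlonglongrightarrow> 0"
    and N: "(\<lambda>n. real (N n) / real (m n)) \<longlonglongrightarrow> 1"
  shows "(\<lambda>n. sq_cdf (s n) ^ N n) \<longlonglongrightarrow> exp (- exp (- z))"
proof -
  note t = tail_limit[OF m s]
  have mpos: "\<forall>\<^sub>F n in sequentially. 0 < m n"
    using m eventually_gt_at_top[of 0] by (auto simp: filterlim_iff)
  have q0: "(\<lambda>n. 1 - sq_cdf (s n)) \<longlonglongrightarrow> 0"
  proof -
    have "(\<lambda>n. real (m n) * (1 - sq_cdf (s n)) / real (m n)) \<longlonglongrightarrow> 0"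
      by (rule real_tendsto_divide_at_top[OF t filterlim_compose[OF filterlim_real_sequentially m]])
    moreover have "\<forall>\<^sub>F n in sequentially. real (m n) * (1 - sq_cdf (s n)) / real (m n) = 1 - sq_cdf (s n)"
      using mpos by eventually_elim simp
    ultimately show ?thesis by (rule Lim_transform_eventually)
  qed
  have "(\<lambda>n. real (N n) / real (m n) * (real (m n) * (1 - sq_cdf (s n)))) \<longlonglongrightarrow> 1 * exp (- z)"
    by (intro tendsto_intros N t)
  moreover have "\<forall>\<^sub>F n in sequentially. real (N n) / real (m n) * (real (m n) * (1 - sq_cdf (s n))) = real (N n) * (1 - sq_cdf (s n))"
    using mpos by eventually_elim simp
  ultimately have "(\<lambda>n. real (N n) * (1 - sq_cdf (s n))) \<longlonglongrightarrow> exp (- z)"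
    by (simp add: Lim_transform_eventually)
  from power_one_minus_tendsto[OF _ q0 this] show ?thesis
    using sq_cdf_range by simp
qed

section \<open>Estimating the correlation error\<close>

lemma correlation_error_nonneg: "0 \<le> correlation_error I G \<phi> s"
  unfolding correlation_error_def by (intro sum_nonneg) auto

text \<open>
  Pairs with correlation at least \<open>1/4\<close> are controlled by \<open>\<bar>\<kappa>\<bar> \<le> 4 \<kappa>\<^sup>2\<close>, the other ones by
  \<open>2 \<bar>\<kappa>\<bar> \<le> \<surd>m \<kappa>\<^sup>2 + 1/\<surd>m\<close>.
\<close>

lemma correlation_error_le:
  fixes m b :: real
  assumes G: "finite G" "real (card G) \<le> m" and m: "0 < m" and s: "0 \<le> s"
    and b: "(\<Sum>i\<in>G. \<Sum>j\<in>G. (inner_on I (\<phi> i) (\<phi> j))\<^sup>2) \<le> b * m"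
    and \<rho>: "\<And>i j. i \<in> G \<Longrightarrow> j \<in> G \<Longrightarrow> i \<noteq> j \<Longrightarrow> \<bar>inner_on I (\<phi> i) (\<phi> j)\<bar> \<le> \<rho>"
  shows "correlation_error I G \<phi> s
    \<le> 4 * b * m * exp (- s / (1 + \<rho>)) + (b + 1) / 2 * (m * sqrt m) * exp (- s * (4 / 5))"
proof -
  define k where "k i j = inner_on I (\<phi> i) (\<phi> j)" for i j
  define e1 where "e1 = exp (- s / (1 + \<rho>))"
  define e2 where "e2 = exp (- s * (4 / 5))"
  define h where "h i j = 4 * (k i j)\<^sup>2 * e1 + (sqrt m * (k i j)\<^sup>2 + 1 / sqrt m) / 2 * e2" for i j
  have e: "0 \<le> e1" "0 \<le> e2" by (auto simp: e1_def e2_def)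
  have h0: "0 \<le> h i j" for i j using m e by (simp add: h_def)
  have le: "\<bar>k i j\<bar> * exp (- s / (1 + \<bar>k i j\<bar>)) \<le> h i j" if ij: "i \<in> G" "j \<in> G - {i}" for i j
  proof (cases "1 / 4 \<le> \<bar>k i j\<bar>")
    case True
    have "\<bar>k i j\<bar> * 1 \<le> \<bar>k i j\<bar> * (4 * \<bar>k i j\<bar>)" using True by (intro mult_left_mono) auto
    then have "\<bar>k i j\<bar> \<le> 4 * (k i j)\<^sup>2" by (simp add: power2_eq_square mult.left_commute)
    moreover have "exp (- s / (1 + \<bar>k i j\<bar>)) \<le> e1"
    proof -
      have "\<bar>k i j\<bar> \<le> \<rho>" using \<rho>[of i j] ij by (auto simp: k_def)
      then show ?thesis using s by (auto simp: e1_def intro!: divide_left_mono mult_pos_pos)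
    qed
    ultimately have "\<bar>k i j\<bar> * exp (- s / (1 + \<bar>k i j\<bar>)) \<le> 4 * (k i j)\<^sup>2 * e1"
      by (intro mult_mono) auto
    moreover have "0 \<le> (sqrt m * (k i j)\<^sup>2 + 1 / sqrt m) / 2 * e2" using m e by simp
    ultimately show ?thesis unfolding h_def by linarith
  next
    case False
    have "0 \<le> (sqrt m * \<bar>k i j\<bar> - 1)\<^sup>2 / sqrt m" using m by simp
    also have "\<dots> = sqrt m * (k i j)\<^sup>2 + 1 / sqrt m - 2 * \<bar>k i j\<bar>"
      using m by (simp add: power2_eq_square field_simps)
    finally have "\<bar>k i j\<bar> \<le> (sqrt m * (k i j)\<^sup>2 + 1 / sqrt m) / 2" by simp
    moreover have "exp (- s / (1 + \<bar>k i j\<bar>)) \<le> e2"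
    proof -
      \<comment> \<open>Correlations below 1/4 have 1 + |\<kappa>| \<le> 5/4; this is the origin of
        the exponent 4/5.\<close>
      have "s / (5 / 4) \<le> s / (1 + \<bar>k i j\<bar>)" using False s by (intro divide_left_mono) auto
      then show ?thesis by (simp add: e2_def)
    qed
    ultimately have "\<bar>k i j\<bar> * exp (- s / (1 + \<bar>k i j\<bar>)) \<le> (sqrt m * (k i j)\<^sup>2 + 1 / sqrt m) / 2 * e2"
      using m by (intro mult_mono) auto
    moreover have "0 \<le> 4 * (k i j)\<^sup>2 * e1" using e by simp
    ultimately show ?thesis unfolding h_def by linarith
  qed
  define S where "S = (\<Sum>i\<in>G. \<Sum>j\<in>G. (k i j)\<^sup>2)"
  have S: "S \<le> b * m" using b by (simp add: S_def k_def)
  have "correlation_error I G \<phi> s \<le> (\<Sum>i\<in>G. \<Sum>j\<in>G - {i}. h i j)"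
    unfolding correlation_error_def k_def[symmetric] by (intro sum_mono le)
  also have "\<dots> \<le> (\<Sum>i\<in>G. \<Sum>j\<in>G. h i j)"
    using G h0 by (intro sum_mono sum_mono2) auto
  \<comment> \<open>The summand 1 / sqrt m is constant, hence it is counted once for each of the at
    most m^2 pairs and yields m sqrt m.\<close>
  also have "\<dots> = 4 * e1 * S + sqrt m / 2 * e2 * S + real (card G) * real (card G) * (1 / sqrt m / 2 * e2)"
    unfolding h_def S_def
    by (simp add: sum.distrib sum_distrib_left sum_distrib_right algebra_simps add_divide_distrib)
  also have "\<dots> \<le> 4 * e1 * (b * m) + sqrt m / 2 * e2 * (b * m) + m * m * (1 / sqrt m / 2 * e2)"
    using G m e S by (intro add_mono mult_left_mono mult_right_mono mult_mono) auto
  also have "m * m * (1 / sqrt m / 2 * e2) = m * sqrt m / 2 * e2"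
    using m real_div_sqrt[of m] by (simp add: field_simps)
  finally show ?thesis
    unfolding e1_def[symmetric] e2_def[symmetric] by (simp add: algebra_simps add_divide_distrib)
qed

text \<open>As s is about 2 log m, the first term behaves like m^(1 - 2 / (1 + \<rho>)), a negative
  power because \<rho> < 1, and the second like m^(3/2 - 8/5) = m^(-1/10). Logarithmic factors do
  not matter. Any splitting point below 1/3 instead of 1/4 would make the second power
  negative.\<close>

lemma correlation_bound_limit:
  fixes m :: "nat \<Rightarrow> nat" and b :: real
  assumes m: "filterlim m at_top at_top" and s: "(\<lambda>n. s n - ev_level z (m n)) \<longlonglongrightarrow> 0"
    and \<rho>: "0 < \<rho>" "\<rho> < 1" and b: "0 \<le> b"
  shows "(\<lambda>n. (s n + c) * (4 * b * m n * exp (- s n / (1 + \<rho>)) + (b + 1) / 2 * (m n * sqrt (m n)) * exp (- s n * (4 / 5)))) \<longlonglongrightarrow> 0"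
proof -
  define \<gamma> where "\<gamma> = 1 / (1 + \<rho>)"
  have \<gamma>: "0 < \<gamma>" "0 < 2 * \<gamma> - 1" using \<rho> by (auto simp: \<gamma>_def field_simps)
  define d where "d = 2 * \<gamma> - 1"
  \<comment> \<open>An explicit majorant in x = m: eventually s + c \<le> 3 ln x, and s is at least
    the level minus 1.\<close>
  define F where "F x = (3 * ln x) * (4 * b * exp (- d * ln x + \<gamma> * ln (ln x) + \<gamma> * (ln pi - 2 * z + 1))
      + (b + 1) / 2 * (x * sqrt x) * exp (- (2 * ln x - ln (ln x) - ln pi + 2 * z - 1) * (4 / 5)))" for x :: real
  have d: "d > 0" using \<gamma> by (simp add: d_def)
  have "((\<lambda>x. ln x * exp (- d * ln x + \<gamma> * ln (ln x) + c1)) \<longlongrightarrow> 0) at_top" for c1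
    using \<gamma>(1) d by real_asymp
  moreover have "((\<lambda>x. ln x * ((x * sqrt x) * exp (- (2 * ln x - ln (ln x) + c2) * (4 / 5)))) \<longlongrightarrow> 0) at_top" for c2 :: real
    by real_asymp
  ultimately have "((\<lambda>x. 12 * b * (ln x * exp (- d * ln x + \<gamma> * ln (ln x) + \<gamma> * (ln pi - 2 * z + 1)))
      + 3 * (b + 1) / 2 * (ln x * ((x * sqrt x) * exp (- (2 * ln x - ln (ln x) + (2 * z - 1 - ln pi)) * (4 / 5))))) \<longlongrightarrow> 0) at_top"
    by (intro tendsto_add_zero tendsto_mult_right_zero)
  also have "(\<lambda>x. 12 * b * (ln x * exp (- d * ln x + \<gamma> * ln (ln x) + \<gamma> * (ln pi - 2 * z + 1)))
      + 3 * (b + 1) / 2 * (ln x * ((x * sqrt x) * exp (- (2 * ln x - ln (ln x) + (2 * z - 1 - ln pi)) * (4 / 5))))) = F"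
    by (intro ext) (simp add: F_def algebra_simps)
  finally have lim: "(\<lambda>n. F (real (m n))) \<longlonglongrightarrow> 0"
    by (rule filterlim_compose[OF _ filterlim_compose[OF filterlim_real_sequentially m]])
  have sc: "filterlim (\<lambda>n. s n + c) at_top at_top"
    using filterlim_tendsto_add_at_top[OF tendsto_const[of c] level_at_top[OF m s]] by (simp add: add.commute)
  have "(\<lambda>n. s n / ln (real (m n)) + c / ln (real (m n))) \<longlonglongrightarrow> 2 + 0"
    by (intro tendsto_add level_div_ln[OF m s] real_tendsto_divide_at_top[OF tendsto_const] filterlim_ln_m[OF m s])
  then have "\<forall>\<^sub>F n in sequentially. (s n + c) / ln (real (m n)) < 3"
    using order_tendstoD(2)[of _ "2::real" sequentially 3] by (simp add: add_divide_distrib)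
  moreover have "\<forall>\<^sub>F n in sequentially. 0 < s n + c"
    using sc by (auto simp: filterlim_at_top_dense)
  moreover have "\<forall>\<^sub>F n in sequentially. 0 < ln (real (m n))"
    using filterlim_ln_m[OF m s] by (auto simp: filterlim_at_top_dense)
  moreover have "\<forall>\<^sub>F n in sequentially. -1 < s n - ev_level z (m n)"
    using order_tendstoD(1)[OF s, of "-1"] by simp
  ultimately have "\<forall>\<^sub>F n in sequentially. norm ((s n + c) * (4 * b * m n * exp (- s n / (1 + \<rho>)) + (b + 1) / 2 * (m n * sqrt (m n)) * exp (- s n * (4 / 5)))) \<le> F (real (m n))"
  proof eventually_elim
    case (elim n)
    define x where "x = real (m n)"
    have x: "0 < x" "0 < ln x" using elim(3) by (cases "m n"; simp add: x_def)+
    have s1: "2 * ln x - ln (ln x) - ln pi + 2 * z - 1 \<le> s n"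
      using elim(4) by (simp add: ev_level_def x_def)
    have "x * exp (- s n / (1 + \<rho>)) = exp (ln x - \<gamma> * s n)"
      using x by (simp add: exp_diff \<gamma>_def exp_minus divide_inverse mult.commute)
    also have "\<dots> \<le> exp (ln x - \<gamma> * (2 * ln x - ln (ln x) - ln pi + 2 * z - 1))"
      using s1 \<gamma> by simp
    also have "ln x - \<gamma> * (2 * ln x - ln (ln x) - ln pi + 2 * z - 1) = - d * ln x + \<gamma> * ln (ln x) + \<gamma> * (ln pi - 2 * z + 1)"
      by (simp add: d_def algebra_simps)
    finally have 1: "x * exp (- s n / (1 + \<rho>)) \<le> exp (- d * ln x + \<gamma> * ln (ln x) + \<gamma> * (ln pi - 2 * z + 1))" .
    have 2: "exp (- s n * (4 / 5)) \<le> exp (- (2 * ln x - ln (ln x) - ln pi + 2 * z - 1) * (4 / 5))"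
      using s1 by simp
    have "4 * b * (x * exp (- s n / (1 + \<rho>))) + (b + 1) / 2 * (x * sqrt x) * exp (- s n * (4 / 5))
        \<le> 4 * b * exp (- d * ln x + \<gamma> * ln (ln x) + \<gamma> * (ln pi - 2 * z + 1))
      + (b + 1) / 2 * (x * sqrt x) * exp (- (2 * ln x - ln (ln x) - ln pi + 2 * z - 1) * (4 / 5))"
      using 1 2 b x by (intro add_mono mult_left_mono) auto
    moreover have "s n + c \<le> 3 * ln x" using elim(1) x by (simp add: x_def divide_less_eq)
    ultimately have "(s n + c) * (4 * b * (x * exp (- s n / (1 + \<rho>))) + (b + 1) / 2 * (x * sqrt x) * exp (- s n * (4 / 5))) \<le> F x"
      unfolding F_def using elim(2) b x by (intro mult_mono) auto
    moreover have "0 \<le> (s n + c) * (4 * b * (x * exp (- s n / (1 + \<rho>))) + (b + 1) / 2 * (x * sqrt x) * exp (- s n * (4 / 5)))"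
      using elim(2) b x by (intro mult_nonneg_nonneg[of "s n + c"] add_nonneg_nonneg[of "4 * b * _"]) auto
    ultimately show ?case by (simp add: x_def mult.assoc)
  qed
  then show ?thesis by (rule Lim_null_comparison[OF _ lim])
qed

section \<open>Frames\<close>

text \<open>Gaussian elimination, by induction on the equations: a nonzero row \<open>v\<close> is
  solved for a pivot variable \<open>p\<close>, which leaves one equation and one unknown
  fewer.\<close>

lemma homogeneous_system_nontrivial:
  fixes \<phi> :: "'w \<Rightarrow> 'i \<Rightarrow> real"
  assumes "finite \<Omega>" "finite I" "card \<Omega> < card I"
  shows "\<exists>u. (\<exists>i\<in>I. u i \<noteq> 0) \<and> (\<forall>\<omega>\<in>\<Omega>. inner_on I (\<phi> \<omega>) u = 0)"
  using assms
proof (induction \<Omega> arbitrary: I \<phi> rule: finite_induct)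
  case empty
  then obtain i where "i \<in> I" by fastforce
  then show ?case by (intro exI[of _ "\<lambda>_. 1"]) auto
next
  case (insert v \<Omega>)
  show ?case
  proof (cases "\<forall>i\<in>I. \<phi> v i = 0")
    case True
    with insert.IH[of I \<phi>] insert.prems insert.hyps show ?thesis
      by (auto simp: inner_on_def)
  next
    case False
    then obtain p where p: "p \<in> I" "\<phi> v p \<noteq> 0" by auto
    define J where "J = I - {p}"
    \<comment> \<open>Row \<open>w\<close> after subtracting the multiple of row \<open>v\<close>
      that clears its entry at the pivot.\<close>
    define \<psi> where "\<psi> w i = \<phi> w i - \<phi> w p / \<phi> v p * \<phi> v i" for w i
    have "card \<Omega> < card J" using insert.prems insert.hyps p by (simp add: J_def)
    then obtain u where u: "\<exists>i\<in>J. u i \<noteq> 0" "\<And>w. w \<in> \<Omega> \<Longrightarrow> inner_on J (\<psi> w) u = 0"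
      using insert.IH[of J \<psi>] insert.prems by (auto simp: J_def)
    define c where "c = - inner_on J (\<phi> v) u / \<phi> v p"
    have eq: "inner_on I f (u(p := c)) = f p * c + inner_on J f u" for f
      using inner_on_upd[OF insert.prems(1) p(1), of f u c]
      unfolding J_def by (simp add: fun_upd_def)
    have "inner_on I (\<phi> v) (u(p := c)) = 0"
      unfolding eq using p by (simp add: c_def)
    moreover have "inner_on I (\<phi> w) (u(p := c)) = 0" if "w \<in> \<Omega>" for w
    proof -
      have "inner_on J (\<phi> w) u = \<phi> w p / \<phi> v p * inner_on J (\<phi> v) u"
        using u(2)[OF that] unfolding \<psi>_def inner_on_linear by simp
      then show ?thesis unfolding eq by (simp add: c_def)
    qed
    moreover have "\<exists>i\<in>I. (u(p := c)) i \<noteq> 0" using u(1) by (auto simp: J_def)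
    ultimately show ?thesis by blast
  qed
qed

lemma inner_on_restrict: "inner_on I u (restrict v I) = inner_on I u v"
  by (rule inner_on_cong) auto

text \<open>The lower frame bound excludes a nonzero vector orthogonal to all elements. This is what
  drives the number of elements to infinity.\<close>

lemma frame_card_le:
  assumes fr: "is_frame I \<Omega> \<phi>" and I: "finite I"
  shows "card I \<le> card \<Omega>"
proof (rule ccontr)
  assume "\<not> ?thesis"
  then obtain u where u: "\<exists>i\<in>I. u i \<noteq> 0" "\<And>w. w \<in> \<Omega> \<Longrightarrow> inner_on I (\<phi> w) u = 0"
    using homogeneous_system_nontrivial[of \<Omega> I \<phi>] fr I by (auto simp: is_frame_def)
  obtain a b where ab: "frame_constants I \<Omega> \<phi> a b" using fr by (auto simp: is_frame_def)
  then have "a * (L2_set (restrict u I) I)\<^sup>2 \<le> (\<Sum>\<omega>\<in>\<Omega>. \<bar>inner_on I (\<phi> \<omega>) (restrict u I)\<bar>\<^sup>2)"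
    unfolding frame_constants_def by auto
  also have "\<dots> = 0" using u by (simp add: inner_on_restrict)
  finally have "(L2_set (restrict u I) I)\<^sup>2 \<le> 0"
    using ab by (simp add: frame_constants_def mult_le_0_iff)
  then show False using u(1) I by (auto simp: L2_set_eq_0_iff)
qed

text \<open>
  The \<open>LEAST\<close> in the definition of the bound is meaningful only because the infimum of all upper
  constants is again one.
\<close>

lemma frame_upper_bound:
  assumes fr: "is_frame I \<Omega> \<phi>" and I: "finite I" "I \<noteq> {}" and u: "u \<in> extensional I"
  shows "(\<Sum>\<omega>\<in>\<Omega>. \<bar>inner_on I (\<phi> \<omega>) u\<bar>\<^sup>2) \<le> upper_frame_bound I \<Omega> \<phi> * (L2_set u I)\<^sup>2"
proof -
  define S where "S = {b. \<exists>a. frame_constants I \<Omega> \<phi> a b}"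
  define q where "q u = (\<Sum>\<omega>\<in>\<Omega>. \<bar>inner_on I (\<phi> \<omega>) u\<bar>\<^sup>2)" for u
  obtain a b where ab: "frame_constants I \<Omega> \<phi> a b" using fr by (auto simp: is_frame_def)
  have q0: "0 \<le> q u" for u unfolding q_def by (intro sum_nonneg) auto
  have S_le: "q u \<le> b * (L2_set u I)\<^sup>2" if "b \<in> S" "u \<in> extensional I" for b u
    using that unfolding S_def frame_constants_def q_def by blast
  obtain i0 where i0: "i0 \<in> I" using I by auto
  \<comment> \<open>A unit vector shows that every upper constant is at least \<open>a\<close>, so
    the infimum exists and still satisfies 0 < a \<le> b.\<close>
  define e where "e = (\<lambda>i\<in>I. if i = i0 then 1 else 0 :: real)"
  have e: "e \<in> extensional I" "L2_set e I = 1"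
    using I i0 by (auto simp: e_def L2_set_def if_distrib[of "\<lambda>x. x\<^sup>2"] cong: if_cong)
  have lb: "a \<le> b" if "b \<in> S" for b
  proof -
    have "a * 1 \<le> q e" using ab e unfolding frame_constants_def q_def by (metis power_one)
    also have "\<dots> \<le> b * 1" using S_le[OF that e(1)] e(2) by simp
    finally show ?thesis by simp
  qed
  then have bdd: "bdd_below S" by (auto simp: bdd_below_def)
  have "b \<in> S" using ab by (auto simp: S_def)
  then have ne: "S \<noteq> {}" by auto
  have aI: "a \<le> Inf S" using ne lb by (rule cInf_greatest)
  have InfS: "q u \<le> Inf S * (L2_set u I)\<^sup>2" if u: "u \<in> extensional I" for u
  proof (cases "L2_set u I = 0")
    case True
    then show ?thesis using S_le[OF \<open>b \<in> S\<close> u] by simp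
  next
    case False
    then have "q u / (L2_set u I)\<^sup>2 \<le> Inf S"
      using S_le[OF _ u] by (intro cInf_greatest ne) (simp add: divide_le_eq)
    then show ?thesis using False by (simp add: divide_le_eq)
  qed
  have "frame_constants I \<Omega> \<phi> a (Inf S)"
    using ab aI InfS unfolding frame_constants_def q_def by auto
  then have "upper_frame_bound I \<Omega> \<phi> = Inf S"
    unfolding upper_frame_bound_def
    by (intro Least_equality) (auto simp: S_def intro!: cInf_lower bdd[unfolded S_def])
  then show ?thesis using InfS[OF u] by (simp add: q_def)
qed

text \<open>The upper frame inequality applied to the unit vector \<open>\<phi> v\<close> bounds
  each row of squared Gram entries by \<open>b\<close>.\<close>

lemma frame_correlation_sum:
  assumes fr: "is_frame I \<Omega> \<phi>" and I: "finite I" "I \<noteq> {}" and B: "upper_frame_bound I \<Omega> \<phi> \<le> b"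
    and unit: "\<And>w. w \<in> \<Omega> \<Longrightarrow> L2_set (\<phi> w) I = 1"
  shows "(\<Sum>v\<in>\<Omega>. \<Sum>w\<in>\<Omega>. (inner_on I (\<phi> v) (\<phi> w))\<^sup>2) \<le> b * real (card \<Omega>)"
proof -
  have "(\<Sum>w\<in>\<Omega>. (inner_on I (\<phi> v) (\<phi> w))\<^sup>2) \<le> b" if v: "v \<in> \<Omega>" for v
  proof -
    have "\<phi> v \<in> extensional I" using fr v by (auto simp: is_frame_def)
    from frame_upper_bound[OF fr I this] show ?thesis
      using B unit[OF v] by (simp add: inner_on_commute[of I "\<phi> v"])
  qed
  then have "(\<Sum>v\<in>\<Omega>. \<Sum>w\<in>\<Omega>. (inner_on I (\<phi> v) (\<phi> w))\<^sup>2) \<le> (\<Sum>v\<in>\<Omega>. b)"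
    by (rule sum_mono)
  then show ?thesis by (simp add: mult.commute)
qed

text \<open>Frames are abstracted here to what the comparison uses: unit vectors, a linear bound on
  the sum of squared correlations, and few strongly correlated pairs.\<close>

theorem gauss_max_limit:
  fixes I :: "nat \<Rightarrow> 'i set" and \<Omega> :: "nat \<Rightarrow> 'w set" and \<phi> :: "nat \<Rightarrow> 'w \<Rightarrow> 'i \<Rightarrow> real"
    and b \<rho> z :: real and T :: "nat \<Rightarrow> real"
  assumes I: "\<And>n. n \<ge> 1 \<Longrightarrow> finite (I n)" and \<Omega>: "\<And>n. n \<ge> 1 \<Longrightarrow> finite (\<Omega> n)"
    and unit: "\<And>n w. n \<ge> 1 \<Longrightarrow> w \<in> \<Omega> n \<Longrightarrow> inner_on (I n) (\<phi> n w) (\<phi> n w) = 1"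
    and m: "filterlim (\<lambda>n. card (\<Omega> n)) at_top at_top"
    and b: "0 \<le> b" "\<And>n. n \<ge> 1 \<Longrightarrow>
      (\<Sum>v\<in>\<Omega> n. \<Sum>w\<in>\<Omega> n. (inner_on (I n) (\<phi> n v) (\<phi> n w))\<^sup>2) \<le> b * real (card (\<Omega> n))"
    and \<rho>: "0 < \<rho>" "\<rho> < 1"
    and pairs: "(\<lambda>n. real (card {(v, w). v \<in> \<Omega> n \<and> w \<in> \<Omega> n \<and> v \<noteq> w \<and> \<bar>inner_on (I n) (\<phi> n v) (\<phi> n w)\<bar> \<ge> \<rho>}))
      \<in> o(\<lambda>n. real (card (\<Omega> n)) / sqrt (ln (real (card (\<Omega> n)))))"
    and T: "\<forall>\<^sub>F n in sequentially. 0 \<le> T n" "(\<lambda>n. (T n)\<^sup>2 - ev_level z (card (\<Omega> n))) \<longlonglongrightarrow> 0"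
  shows "(\<lambda>n. measure (gauss (I n)) {\<xi>\<in>space (gauss (I n)). \<forall>w\<in>\<Omega> n. \<bar>inner_on (I n) (\<phi> n w) \<xi>\<bar> \<le> T n})
    \<longlonglongrightarrow> exp (- exp (- z))"
proof -
  define P where "P n A = measure (gauss (I n)) {\<xi>\<in>space (gauss (I n)). \<forall>w\<in>A. \<bar>inner_on (I n) (\<phi> n w) \<xi>\<bar> \<le> T n}" for n A
  define mm where "mm n = card (\<Omega> n)" for n
  define Q where "Q n = {(v, w). v \<in> \<Omega> n \<and> w \<in> \<Omega> n \<and> v \<noteq> w \<and> \<bar>inner_on (I n) (\<phi> n v) (\<phi> n w)\<bar> \<ge> \<rho>}" for n
  \<comment> \<open>Removing the first components leaves no pair of \<open>Q n\<close> inside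
    \<open>G n\<close> and costs at most \<open>card (Q n)\<close> elements.\<close>
  define B where "B n = fst ` Q n" for n
  define G where "G n = \<Omega> n - B n" for n
  note m' = m[folded mm_def] and T' = T(2)[folded mm_def]
  have ev1: "\<forall>\<^sub>F n::nat in sequentially. 1 \<le> n" by (rule eventually_ge_at_top)
  have ln_top: "filterlim (\<lambda>n. ln (real (mm n))) at_top at_top"
    by (rule filterlim_ln_m[OF m' T'])
  have mpos: "\<forall>\<^sub>F n in sequentially. 0 < mm n"
    using m' eventually_gt_at_top[of 0] by (auto simp: filterlim_iff)
  have QB: "finite (B n)" "B n \<subseteq> \<Omega> n" "card (B n) \<le> card (Q n)" if "1 \<le> n" for n
  proof -
    have "Q n \<subseteq> \<Omega> n \<times> \<Omega> n" by (auto simp: Q_def)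
    then have "finite (Q n)" using \<Omega>[OF that] finite_subset by blast
    then show "finite (B n)" "B n \<subseteq> \<Omega> n" "card (B n) \<le> card (Q n)"
      by (auto simp: B_def Q_def intro: card_image_le)
  qed
  have G_corr: "\<bar>inner_on (I n) (\<phi> n v) (\<phi> n w)\<bar> \<le> \<rho>" if "v \<in> G n" "w \<in> G n" "v \<noteq> w" for n v w
  proof (rule ccontr)
    assume "\<not> ?thesis"
    then have "(v, w) \<in> Q n" using that by (auto simp: Q_def G_def)
    then have "v \<in> B n" by (force simp: B_def)
    then show False using that by (simp add: G_def)
  qed
  have G: "finite (G n)" "G n \<subseteq> \<Omega> n" "G n \<union> B n = \<Omega> n" "card (G n) + card (B n) = mm n" if "1 \<le> n" for n
  proof -
    show "finite (G n)" "G n \<subseteq> \<Omega> n" using \<Omega>[OF that] by (auto simp: G_def)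
    show "G n \<union> B n = \<Omega> n" using QB[OF that] by (auto simp: G_def)
    show "card (G n) + card (B n) = mm n"
      using card_Diff_subset[OF QB(1,2)[OF that]] card_mono[OF \<Omega>[OF that] QB(2)[OF that]]
      by (simp add: G_def mm_def)
  qed

  have Bs: "(\<lambda>n. real (card (B n)) * sqrt (ln (real (mm n))) / real (mm n)) \<longlonglongrightarrow> 0"
  proof (rule tendsto_sandwich[OF _ _ tendsto_const])
    show "(\<lambda>n. real (card (Q n)) / (real (mm n) / sqrt (ln (real (mm n))))) \<longlonglongrightarrow> 0"
      using smalloD_tendsto[OF pairs] by (simp add: Q_def mm_def)
    show "\<forall>\<^sub>F n in sequentially. 0 \<le> real (card (B n)) * sqrt (ln (real (mm n))) / real (mm n)"
      using mpos by eventually_elim auto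
    show "\<forall>\<^sub>F n in sequentially. real (card (B n)) * sqrt (ln (real (mm n))) / real (mm n)
        \<le> real (card (Q n)) / (real (mm n) / sqrt (ln (real (mm n))))"
      using mpos ev1
    proof eventually_elim
      case (elim n)
      then have "real (card (B n)) * sqrt (ln (real (mm n))) \<le> real (card (Q n)) * sqrt (ln (real (mm n)))"
        using QB[of n] by (intro mult_right_mono) auto
      then show ?case by (simp add: divide_right_mono)
    qed
  qed
  have Bm: "(\<lambda>n. real (card (B n)) / real (mm n)) \<longlonglongrightarrow> 0"
  proof (rule tendsto_sandwich[OF _ _ tendsto_const Bs])
    show "\<forall>\<^sub>F n in sequentially. real (card (B n)) / real (mm n) \<le> real (card (B n)) * sqrt (ln (real (mm n))) / real (mm n)"
      using ln_top[unfolded filterlim_at_top, rule_format, of 1]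
    proof eventually_elim
      case (elim n)
      then have "real (card (B n)) * 1 \<le> real (card (B n)) * sqrt (ln (real (mm n)))"
        by (intro mult_left_mono) auto
      then show ?case by (simp add: divide_right_mono)
    qed
  qed auto
  have Gm: "(\<lambda>n. real (card (G n)) / real (mm n)) \<longlonglongrightarrow> 1"
  proof -
    have "(\<lambda>n. 1 - real (card (B n)) / real (mm n)) \<longlonglongrightarrow> 1 - 0"
      by (intro tendsto_intros Bm)
    moreover have "\<forall>\<^sub>F n in sequentially. 1 - real (card (B n)) / real (mm n) = real (card (G n)) / real (mm n)"
      using mpos ev1
    proof eventually_elim
      case (elim n)
      have "real (mm n) = real (card (G n)) + real (card (B n))" using G(4)[OF elim(2)] by simp
      then show ?case using elim(1) by (simp add: field_simps)
    qed
    ultimately show ?thesis by (simp add: Lim_transform_eventually)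
  qed
  \<comment> \<open>By \<open>exp_level\<close>, exp (- T^2 / 2) is of order sqrt (log m) / m,
    precisely the scale on which \<open>Bs\<close> makes the removed set negligible.\<close>
  have B_tail: "(\<lambda>n. 2 * real (card (B n)) * exp (- (T n)\<^sup>2 / 2)) \<longlonglongrightarrow> 0"
  proof -
    have "(\<lambda>n. 2 * (real (card (B n)) * sqrt (ln (real (mm n))) / real (mm n)) * sqrt pi
        * exp (- z - ((T n)\<^sup>2 - ev_level z (mm n)) / 2)) \<longlonglongrightarrow> 2 * 0 * sqrt pi * exp (- z - 0 / 2)"
      by (intro tendsto_intros Bs T')  simp
    moreover have "\<forall>\<^sub>F n in sequentially. 2 * (real (card (B n)) * sqrt (ln (real (mm n))) / real (mm n)) * sqrt pi
        * exp (- z - ((T n)\<^sup>2 - ev_level z (mm n)) / 2) = 2 * real (card (B n)) * exp (- (T n)\<^sup>2 / 2)"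
      using mpos exp_level[OF m' T']
    proof eventually_elim
      case (elim n)
      define E where "E = exp (- z - ((T n)\<^sup>2 - ev_level z (mm n)) / 2)"
      have "exp (- (T n)\<^sup>2 / 2) = sqrt pi * sqrt (ln (real (mm n))) * E / real (mm n)"
        using elim by (simp add: E_def real_sqrt_mult field_simps)
      then show ?case unfolding E_def[symmetric] by simp
    qed
    ultimately show ?thesis by (simp add: Lim_transform_eventually)
  qed
  \<comment> \<open>The offset \<open>c\<close> accounts for the squared slope: s + c is T^2 +
    \<delta> in the upper estimate, where s = T^2, and T^2 in the lower one, where s = T^2 -
    \<delta>.\<close>
  have corr: "(\<lambda>n. (s n + c) * correlation_error (I n) (G n) (\<phi> n) (s n)) \<longlonglongrightarrow> 0"
    if s: "(\<lambda>n. s n - ev_level z' (mm n)) \<longlonglongrightarrow> 0" for s z' c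
  proof (rule tendsto_sandwich[OF _ _ tendsto_const correlation_bound_limit[OF m' s \<rho> b(1)]])
    have "filterlim (\<lambda>n. s n + c) at_top at_top"
      using filterlim_tendsto_add_at_top[OF tendsto_const[of c] level_at_top[OF m' s]] by (simp add: add.commute)
    then have pos: "\<forall>\<^sub>F n in sequentially. 0 < s n + c" by (simp add: filterlim_at_top_dense)
    have spos: "\<forall>\<^sub>F n in sequentially. 0 < s n"
      using level_at_top[OF m' s] by (simp add: filterlim_at_top_dense)
    show "\<forall>\<^sub>F n in sequentially. 0 \<le> (s n + c) * correlation_error (I n) (G n) (\<phi> n) (s n)"
      using pos by eventually_elim (simp add: correlation_error_nonneg)
    show "\<forall>\<^sub>F n in sequentially. (s n + c) * correlation_error (I n) (G n) (\<phi> n) (s n)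
      \<le> (s n + c) * (4 * b * real (mm n) * exp (- s n / (1 + \<rho>)) + (b + 1) / 2 * (real (mm n) * sqrt (real (mm n))) * exp (- s n * (4 / 5)))"
      using pos spos mpos ev1
    proof eventually_elim
      case (elim n)
      have "(\<Sum>i\<in>G n. \<Sum>j\<in>G n. (inner_on (I n) (\<phi> n i) (\<phi> n j))\<^sup>2)
          \<le> (\<Sum>i\<in>\<Omega> n. \<Sum>j\<in>\<Omega> n. (inner_on (I n) (\<phi> n i) (\<phi> n j))\<^sup>2)"
        using G(2)[OF elim(4)] \<Omega>[OF elim(4)]
        by (intro order_trans[OF sum_mono[OF sum_mono2] sum_mono2] sum_nonneg) auto
      also have "\<dots> \<le> b * real (mm n)" using b(2)[OF elim(4)] by (simp add: mm_def)
      finally have "correlation_error (I n) (G n) (\<phi> n) (s n)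
        \<le> 4 * b * real (mm n) * exp (- s n / (1 + \<rho>)) + (b + 1) / 2 * (real (mm n) * sqrt (real (mm n))) * exp (- s n * (4 / 5))"
        using elim G[OF elim(4)] G_corr by (intro correlation_error_le) auto
      then show ?case using elim(1) by (intro mult_left_mono) auto
    qed
  qed
  have upper: "\<forall>\<^sub>F n in sequentially. P n (\<Omega> n) < a" if a: "exp (- exp (- (z + \<delta> / 2))) < a" and \<delta>: "0 < \<delta>" for a \<delta>
  proof -
    have s: "(\<lambda>n. ((T n)\<^sup>2 + \<delta>) - ev_level (z + \<delta> / 2) (mm n)) \<longlonglongrightarrow> 0"
      using T' by (simp add: ev_level_def algebra_simps)
    have "(\<lambda>n. sq_cdf ((T n)\<^sup>2 + \<delta>) ^ card (G n)
        + 32 * pi / \<delta>\<^sup>2 * (((T n)\<^sup>2 + \<delta>) * correlation_error (I n) (G n) (\<phi> n) ((T n)\<^sup>2)))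
        \<longlonglongrightarrow> exp (- exp (- (z + \<delta> / 2))) + 32 * pi / \<delta>\<^sup>2 * 0"
      by (intro tendsto_add tendsto_mult tendsto_const sq_cdf_power_limit[OF m' s Gm] corr[OF T'])
    then have "\<forall>\<^sub>F n in sequentially. sq_cdf ((T n)\<^sup>2 + \<delta>) ^ card (G n)
        + 32 * pi / \<delta>\<^sup>2 * (((T n)\<^sup>2 + \<delta>) * correlation_error (I n) (G n) (\<phi> n) ((T n)\<^sup>2)) < a"
      using a by (intro order_tendstoD(2)) auto
    then show ?thesis
      using T(1) ev1
    proof eventually_elim
      case (elim n)
      interpret gn: prob_space "gauss (I n)" by (rule prob_space_gauss)
      have "P n (\<Omega> n) \<le> P n (G n)"
        unfolding P_def using G[OF elim(3)]
        by (intro gn.finite_measure_mono) auto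
      also have "\<dots> \<le> sq_cdf ((T n)\<^sup>2 + \<delta>) ^ card (G n)
          + 32 * pi * ((T n)\<^sup>2 + \<delta>) / \<delta>\<^sup>2 * correlation_error (I n) (G n) (\<phi> n) ((T n)\<^sup>2)"
        unfolding P_def using G[OF elim(3)] unit[OF elim(3)] elim \<delta> I
        by (intro gauss_max_upper) auto
      also have "\<dots> < a"
        using elim(1) by (simp only: times_divide_eq_left times_divide_eq_right mult.assoc)
      finally show ?case .
    qed
  qed
  have lower: "\<forall>\<^sub>F n in sequentially. a < P n (\<Omega> n)" if a: "a < exp (- exp (- (z - \<delta> / 2)))" and \<delta>: "0 < \<delta>" for a \<delta>
  proof -
    have s: "(\<lambda>n. ((T n)\<^sup>2 - \<delta>) - ev_level (z - \<delta> / 2) (mm n)) \<longlonglongrightarrow> 0"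
      using T' by (simp add: ev_level_def algebra_simps)
    have "(\<lambda>n. sq_cdf ((T n)\<^sup>2 - \<delta>) ^ card (G n)
        - 32 * pi / \<delta>\<^sup>2 * (((T n)\<^sup>2 - \<delta> + \<delta>) * correlation_error (I n) (G n) (\<phi> n) ((T n)\<^sup>2 - \<delta>))
        - 2 * real (card (B n)) * exp (- (T n)\<^sup>2 / 2))
        \<longlonglongrightarrow> exp (- exp (- (z - \<delta> / 2))) - 32 * pi / \<delta>\<^sup>2 * 0 - 0"
      by (intro tendsto_diff tendsto_mult tendsto_const sq_cdf_power_limit[OF m' s Gm] corr[OF s] B_tail)
    then have "\<forall>\<^sub>F n in sequentially. a < sq_cdf ((T n)\<^sup>2 - \<delta>) ^ card (G n)
        - 32 * pi / \<delta>\<^sup>2 * (((T n)\<^sup>2 - \<delta> + \<delta>) * correlation_error (I n) (G n) (\<phi> n) ((T n)\<^sup>2 - \<delta>))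
        - 2 * real (card (B n)) * exp (- (T n)\<^sup>2 / 2)"
      using a by (intro order_tendstoD(1)) auto
    moreover have "\<forall>\<^sub>F n in sequentially. \<delta> < (T n)\<^sup>2"
      using level_at_top[OF m' T'] by (simp add: filterlim_at_top_dense)
    ultimately show ?thesis
      using T(1) ev1
    proof eventually_elim
      case (elim n)
      have "sq_cdf ((T n)\<^sup>2 - \<delta>) ^ card (G n) - 32 * pi * (T n)\<^sup>2 / \<delta>\<^sup>2 * correlation_error (I n) (G n) (\<phi> n) ((T n)\<^sup>2 - \<delta>)
          \<le> P n (G n)"
        unfolding P_def using G[OF elim(4)] unit[OF elim(4)] elim \<delta> I
        by (intro gauss_max_lower) auto
      moreover have "P n (G n) - 2 * real (card (B n)) * exp (- (T n)\<^sup>2 / 2) \<le> P n (G n \<union> B n)"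
        unfolding P_def using G[OF elim(4)] QB[OF elim(4)] unit[OF elim(4)] elim I
        by (intro gauss_max_remove) auto
      moreover have "32 * pi * (T n)\<^sup>2 / \<delta>\<^sup>2 * correlation_error (I n) (G n) (\<phi> n) ((T n)\<^sup>2 - \<delta>)
          = 32 * pi / \<delta>\<^sup>2 * (((T n)\<^sup>2 - \<delta> + \<delta>) * correlation_error (I n) (G n) (\<phi> n) ((T n)\<^sup>2 - \<delta>))"
        by (simp add: mult_ac)
      ultimately show ?case using elim(1) unfolding G(3)[OF elim(4)] by linarith
    qed
  qed
  \<comment> \<open>Continuity of the Gumbel distribution function: a strict inequality at z
    persists after a small shift, upwards for c = 1 and downwards for c = -1.\<close>
  have pick: "\<exists>\<delta>>0. R (exp (- exp (- (z + c * \<delta> / 2))))" if "open (Collect R)" "R (exp (- exp (- z)))" for R and c :: real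
  proof -
    have "((\<lambda>\<delta>. exp (- exp (- (z + c * \<delta> / 2)))) \<longlongrightarrow> exp (- exp (- (z + c * 0 / 2)))) (at_right 0)"
      by (intro tendsto_intros) auto
    then have "\<forall>\<^sub>F \<delta> in at_right 0. exp (- exp (- (z + c * \<delta> / 2))) \<in> Collect R"
      using that by (intro topological_tendstoD) auto
    then have "\<forall>\<^sub>F \<delta> in at_right (0::real). 0 < \<delta> \<and> R (exp (- exp (- (z + c * \<delta> / 2))))"
      using eventually_at_right_less[of "0::real"] by eventually_elim simp
    then show ?thesis using eventually_happens'[OF trivial_limit_at_right_real] by blast
  qed
  have "(\<lambda>n. P n (\<Omega> n)) \<longlonglongrightarrow> exp (- exp (- z))"
  proof (rule order_tendstoI)
    fix a assume "a < exp (- exp (- z))"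
    then obtain \<delta> where "0 < \<delta>" "a < exp (- exp (- (z + (-1) * \<delta> / 2)))"
      using pick[of "\<lambda>x. a < x" "-1"] by (auto simp: open_Collect_less continuous_on_id continuous_on_const)
    then show "\<forall>\<^sub>F n in sequentially. a < P n (\<Omega> n)" using lower[of a \<delta>] by simp
  next
    fix a assume "exp (- exp (- z)) < a"
    then obtain \<delta> where "0 < \<delta>" "exp (- exp (- (z + 1 * \<delta> / 2))) < a"
      using pick[of "\<lambda>x. x < a" 1] by (auto simp: open_Collect_less continuous_on_id continuous_on_const)
    then show "\<forall>\<^sub>F n in sequentially. P n (\<Omega> n) < a" using upper[of \<delta> a] by simp
  qed
  then show ?thesis by (simp add: P_def)
qed

section \<open>Coverage of the sup-norm balls\<close>

lemma (in prob_space) distr_gauss: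
  assumes I: "I \<noteq> {}" and \<sigma>: "0 < \<sigma>"
    and ind: "indep_vars (\<lambda>_. borel) (\<lambda>i s. \<epsilon> s i) I"
    and nrm: "\<And>i. i \<in> I \<Longrightarrow> distributed M lborel (\<lambda>s. \<epsilon> s i) (normal_density 0 \<sigma>)"
  shows "distr M (gauss I) (\<lambda>s. \<lambda>i\<in>I. \<epsilon> s i / \<sigma>) = gauss I"
proof -
  have ind': "indep_vars (\<lambda>_. borel) (\<lambda>i s. \<epsilon> s i / \<sigma>) I"
    by (rule indep_vars_compose2[OF ind, where Y = "\<lambda>_ x. x / \<sigma>"]) simp
  have std: "distributed M lborel (\<lambda>s. \<epsilon> s i / \<sigma>) std_normal_density" if "i \<in> I" for i
    using normal_standard_normal_convert[OF \<sigma>, of "\<lambda>s. \<epsilon> s i" 0] nrm[OF that] by simp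
  have rv: "random_variable borel (\<lambda>s. \<epsilon> s i / \<sigma>)" if "i \<in> I" for i
    using distributed_measurable[OF std[OF that]] by simp
  have "distr M (gauss I) (\<lambda>s. \<lambda>i\<in>I. \<epsilon> s i / \<sigma>) = distr M (\<Pi>\<^sub>M i\<in>I. borel) (\<lambda>s. \<lambda>i\<in>I. \<epsilon> s i / \<sigma>)"
    by (intro distr_cong sets_gauss) auto
  also have "\<dots> = (\<Pi>\<^sub>M i\<in>I. distr M borel (\<lambda>s. \<epsilon> s i / \<sigma>))"
    using indep_vars_iff_distr_eq_PiM'[OF I rv] ind' by simp
  also have "\<dots> = gauss I"
    unfolding gauss_def
  proof (rule PiM_cong[OF refl])
    fix i assume "i \<in> I"
    then show "distr M borel (\<lambda>s. \<epsilon> s i / \<sigma>) = std_normal"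
      using distributed_distr_eq_density[OF std] by (simp cong: distr_cong)
  qed
  finally show ?thesis .
qed

text \<open>Transfers the event to the product measure; dividing the noise by \<sigma> scales all
  coefficients alike.\<close>

lemma (in prob_space) gauss_max_prob:
  fixes \<phi> :: "'w \<Rightarrow> 'i \<Rightarrow> real"
  assumes I: "I \<noteq> {}" "finite I" and \<Omega>: "finite \<Omega>" and \<sigma>: "0 < \<sigma>"
    and ind: "indep_vars (\<lambda>_. borel) (\<lambda>i s. \<epsilon> s i) I"
    and nrm: "\<And>i. i \<in> I \<Longrightarrow> distributed M lborel (\<lambda>s. \<epsilon> s i) (normal_density 0 \<sigma>)"
  shows "prob {s\<in>space M. \<forall>w\<in>\<Omega>. \<bar>inner_on I (\<phi> w) (\<epsilon> s)\<bar> \<le> \<sigma> * T}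
    = measure (gauss I) {\<xi>\<in>space (gauss I). \<forall>w\<in>\<Omega>. \<bar>inner_on I (\<phi> w) \<xi>\<bar> \<le> T}"
proof -
  let ?f = "\<lambda>s. \<lambda>i\<in>I. \<epsilon> s i / \<sigma>"
  define E where "E = {\<xi>\<in>space (gauss I). \<forall>w\<in>\<Omega>. \<bar>inner_on I (\<phi> w) \<xi>\<bar> \<le> T}"
  have E: "E \<in> sets (gauss I)" unfolding E_def using \<Omega> by measurable
  have rv: "(\<lambda>s. \<epsilon> s i) \<in> borel_measurable M" if "i \<in> I" for i
    using distributed_measurable[OF nrm[OF that]] by simp
  have f: "?f \<in> M \<rightarrow>\<^sub>M gauss I"
    unfolding gauss_def using rv by (intro measurable_restrict) simp
  have inner: "inner_on I (\<phi> w) (?f s) = inner_on I (\<phi> w) (\<epsilon> s) / \<sigma>" for w s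
    by (simp add: inner_on_restrict) (simp add: inner_on_def sum_divide_distrib)
  have "measure (gauss I) E = measure (distr M (gauss I) ?f) E"
    using distr_gauss[OF I(1) \<sigma> ind nrm] by simp
  also have "\<dots> = prob (?f -` E \<inter> space M)"
    by (rule measure_distr[OF f E])
  also have "?f -` E \<inter> space M = {s\<in>space M. \<forall>w\<in>\<Omega>. \<bar>inner_on I (\<phi> w) (\<epsilon> s)\<bar> \<le> \<sigma> * T}"
    using measurable_space[OF f] \<sigma> by (auto simp: E_def inner abs_divide divide_le_eq mult.commute)
  finally show ?thesis by (simp add: E_def)
qed

text \<open>Thus z(\<alpha>) is the quantile of order 1 - \<alpha> of the Gumbel law.\<close>

lemma exp_gumbel_quantile:
  assumes "0 < \<alpha>" "\<alpha> < 1"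
  shows "exp (- exp (- gumbel_quantile \<alpha>)) = 1 - \<alpha>"
proof -
  have "0 < ln (1 / (1 - \<alpha>))" using assms by (intro ln_gt_zero) (simp add: field_simps)
  then show ?thesis using assms by (simp add: gumbel_quantile_def ln_div)
qed

text \<open>Allows varying levels to be compared with fixed ones; m \<ge> 2 makes the logarithm in
  the denominator positive.\<close>

lemma ev_threshold_antimono:
  assumes "0 < \<alpha>" "\<alpha> \<le> \<beta>" "\<beta> < 1" "2 \<le> m"
  shows "ev_threshold 1 \<beta> m \<le> ev_threshold 1 \<alpha> m"
proof -
  have "0 < ln (1 / (1 - \<alpha>))" using assms by (intro ln_gt_zero) (simp add: field_simps)
  moreover have "ln (1 / (1 - \<alpha>)) \<le> ln (1 / (1 - \<beta>))"
    using assms by (subst ln_le_cancel_iff) (auto intro!: divide_left_mono)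
  ultimately have "gumbel_quantile \<beta> \<le> gumbel_quantile \<alpha>"
    unfolding gumbel_quantile_def by simp
  moreover have "0 < ln (real m)" using assms by simp
  ultimately show ?thesis
    unfolding ev_threshold_def by (auto intro!: divide_right_mono)
qed

theorem theorem3p6:
  fixes d :: nat and \<sigma> :: real
    and \<Omega> :: "nat \<Rightarrow> 'w set"
    and \<phi> :: "nat \<Rightarrow> 'w \<Rightarrow> (nat \<Rightarrow> nat) \<Rightarrow> real"
    and \<alpha> :: "nat \<Rightarrow> real" and \<alpha>\<^sub>0 :: real
    and M :: "nat \<Rightarrow> 'a measure"
    and \<epsilon> :: "nat \<Rightarrow> 'a \<Rightarrow> (nat \<Rightarrow> nat) \<Rightarrow> real"
    and Y :: "nat \<Rightarrow> ('w \<Rightarrow> real) \<Rightarrow> 'a \<Rightarrow> 'w \<Rightarrow> real"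
  assumes "d \<ge> 1" and "\<sigma> > 0"
    and "asymptotically_stable d \<Omega> \<phi>"
    and "\<And>n. n \<ge> 1 \<Longrightarrow> 0 < \<alpha> n \<and> \<alpha> n < 1"
    and "\<alpha> \<longlonglongrightarrow> \<alpha>\<^sub>0" and "0 \<le> \<alpha>\<^sub>0" and "\<alpha>\<^sub>0 < 1"
    and "\<And>n. n \<ge> 1 \<Longrightarrow> prob_space (M n)"
    and "\<And>n. n \<ge> 1 \<Longrightarrow> \<epsilon> n \<in> M n \<rightarrow>\<^sub>M (\<Pi>\<^sub>M i\<in>grid d n. borel)"
    and "\<And>n. n \<ge> 1 \<Longrightarrow>
           prob_space.indep_vars (M n) (\<lambda>_. borel) (\<lambda>i s. \<epsilon> n s i) (grid d n)"
    and "\<And>n i. n \<ge> 1 \<Longrightarrow> i \<in> grid d n \<Longrightarrow>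
           distributed (M n) lborel (\<lambda>s. \<epsilon> n s i) (normal_density 0 \<sigma>)"
    and "\<And>n x s. Y n x s =
           (\<lambda>\<omega>\<in>\<Omega> n. x \<omega> + analysis_op (grid d n) (\<Omega> n) (\<phi> n) (\<epsilon> n s) \<omega>)"
  shows "(\<lambda>n. measure (M n)
            (\<Inter>x\<in>analysis_range (grid d n) (\<Omega> n) (\<phi> n).
               {s \<in> space (M n).
                  x \<in> sup_ball (\<Omega> n) (Y n x s) (ev_threshold \<sigma> (\<alpha> n) (card (\<Omega> n)))}))
         \<longlonglongrightarrow> 1 - \<alpha>\<^sub>0"
proof -
  define I where "I = grid d"
  note stable = assms(3)[unfolded asymptotically_stable_def, folded I_def]
  have fr: "is_frame (I n) (\<Omega> n) (\<phi> n)" if "n \<ge> 1" for n using stable that by blast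
  have unit: "L2_set (\<phi> n w) (I n) = 1" if "n \<ge> 1" "w \<in> \<Omega> n" for n w using stable that by blast
  obtain \<rho> where \<rho>: "0 < \<rho>" "\<rho> < 1"
    and pairs: "(\<lambda>n. real (card {(v, w). v \<in> \<Omega> n \<and> w \<in> \<Omega> n \<and> v \<noteq> w \<and> \<bar>inner_on (I n) (\<phi> n v) (\<phi> n w)\<bar> \<ge> \<rho>}))
      \<in> o(\<lambda>n. real (card (\<Omega> n)) / sqrt (ln (real (card (\<Omega> n)))))"
    using stable by blast
  have "bdd_above ((\<lambda>n. upper_frame_bound (I n) (\<Omega> n) (\<phi> n)) ` {1..})"
    using stable by (elim conjE)
  then obtain b' where b': "upper_frame_bound (I n) (\<Omega> n) (\<phi> n) \<le> b'" if "n \<ge> 1" for n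
    unfolding bdd_above_def by fastforce
  \<comment> \<open>Truncation at 0 supplies the sign condition of the limit theorem without a
    separate argument for \<open>b'\<close>.\<close>
  define b where "b = max 0 b'"
  have \<Omega>: "finite (\<Omega> n)" if "n \<ge> 1" for n using fr[OF that] by (simp add: is_frame_def)
  have I: "finite (I n)" for n by (auto simp: I_def grid_def intro: finite_PiE)
  have I_ne: "I n \<noteq> {}" if "n \<ge> 1" for n using that by (auto simp: I_def grid_def PiE_eq_empty_iff lessThan_empty_iff)
  have card_I: "card (I n) = n ^ d" for n by (simp add: I_def grid_def card_PiE)
  have card_\<Omega>: "n \<le> card (\<Omega> n)" if "n \<ge> 1" for n
  proof -
    have "n ^ 1 \<le> n ^ d" using assms(1) that by (intro power_increasing) auto
    then show ?thesis using frame_card_le[OF fr[OF that] I] by (simp add: card_I)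
  qed
  have top: "filterlim (\<lambda>n. card (\<Omega> n)) at_top at_top"
    by (rule filterlim_at_top_mono[OF filterlim_ident eventually_mono[OF eventually_ge_at_top[of 1] card_\<Omega>]])
  define P where "P n t = measure (gauss (I n)) {\<xi>\<in>space (gauss (I n)). \<forall>w\<in>\<Omega> n. \<bar>inner_on (I n) (\<phi> n w) \<xi>\<bar> \<le> t}" for n t
  define T where "T \<beta> n = ev_threshold 1 \<beta> (card (\<Omega> n))" for \<beta> n
  have lim: "(\<lambda>n. P n (T \<beta> n)) \<longlonglongrightarrow> 1 - \<beta>" if \<beta>: "0 < \<beta>" "\<beta> < 1" for \<beta>
    unfolding P_def exp_gumbel_quantile[OF \<beta>, symmetric]
  proof (rule gauss_max_limit[where b=b, OF _ \<Omega> _ top _ _ \<rho> pairs])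
    show "finite (I n)" for n by (rule I)
    show "inner_on (I n) (\<phi> n w) (\<phi> n w) = 1" if "n \<ge> 1" "w \<in> \<Omega> n" for n w
      using unit[OF that] by (simp add: inner_on_self_eq_L2)
    show "0 \<le> b" by (simp add: b_def)
    show "(\<Sum>v\<in>\<Omega> n. \<Sum>w\<in>\<Omega> n. (inner_on (I n) (\<phi> n v) (\<phi> n w))\<^sup>2) \<le> b * real (card (\<Omega> n))" if "n \<ge> 1" for n
      using b'[OF that] by (intro frame_correlation_sum fr I I_ne unit that) (auto simp: b_def)
    have "filterlim (\<lambda>n. T \<beta> n) at_top sequentially"
      unfolding T_def by (rule filterlim_compose[OF ev_threshold_at_top top])
    then show "\<forall>\<^sub>F n in sequentially. 0 \<le> T \<beta> n" by (simp add: filterlim_at_top)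
    show "(\<lambda>n. (T \<beta> n)\<^sup>2 - ev_level (gumbel_quantile \<beta>) (card (\<Omega> n))) \<longlonglongrightarrow> 0"
      unfolding T_def by (rule filterlim_compose[OF ev_threshold_sq top])
  qed
  have mono: "P n s \<le> P n t" if "s \<le> t" "n \<ge> 1" for n s t
  proof -
    interpret g: prob_space "gauss (I n)" by (rule prob_space_gauss)
    have "{\<xi>\<in>space (gauss (I n)). \<forall>w\<in>\<Omega> n. \<bar>inner_on (I n) (\<phi> n w) \<xi>\<bar> \<le> t} \<in> sets (gauss (I n))"
      using \<Omega>[OF that(2)] by measurable
    then show ?thesis unfolding P_def using that by (intro g.finite_measure_mono) force+
  qed
  have anti: "P n (T \<beta> n) \<le> P n (T \<gamma> n)" if "0 < \<gamma>" "\<gamma> \<le> \<beta>" "\<beta> < 1" "n \<ge> 2" for \<beta> \<gamma> n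
    unfolding T_def using that card_\<Omega>[of n] by (intro mono ev_threshold_antimono) auto
  \<comment> \<open>The probabilities at level \<open>\<alpha> n\<close> are squeezed by those at
    fixed levels \<beta> on either side of \<open>\<alpha>\<^sub>0\<close>, arbitrarily close to
    it.\<close>
  have PT: "(\<lambda>n. P n (T (\<alpha> n) n)) \<longlonglongrightarrow> 1 - \<alpha>\<^sub>0"
  proof (rule order_tendstoI)
    fix a assume "a < 1 - \<alpha>\<^sub>0"
    then have "\<alpha>\<^sub>0 < min 1 (1 - a)" using assms(7) by auto
    then obtain \<beta> where \<beta>: "\<alpha>\<^sub>0 < \<beta>" "\<beta> < min 1 (1 - a)" using dense by blast
    have "\<forall>\<^sub>F n in sequentially. a < P n (T \<beta> n)"
      using \<beta> assms(6) by (intro order_tendstoD(1)[OF lim]) auto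
    then show "\<forall>\<^sub>F n in sequentially. a < P n (T (\<alpha> n) n)"
      using order_tendstoD(2)[OF assms(5) \<beta>(1)] eventually_ge_at_top[of 2]
    proof eventually_elim
      case (elim n)
      have "P n (T \<beta> n) \<le> P n (T (\<alpha> n) n)"
        using elim \<beta> assms(4)[of n] by (intro anti) auto
      then show ?case using elim by simp
    qed
  next
    fix a assume a: "1 - \<alpha>\<^sub>0 < a"
    show "\<forall>\<^sub>F n in sequentially. P n (T (\<alpha> n) n) < a"
    proof (cases "\<alpha>\<^sub>0 = 0")
      case True
      \<comment> \<open>No admissible \<beta> lies below 0, but here the limit is 1 and every
        probability is at most 1.\<close>
      have "P n t \<le> 1" for n t
        unfolding P_def by (rule prob_space.prob_le_1[OF prob_space_gauss])
      from le_less_trans[OF this] show ?thesis using a True by (intro always_eventually allI) simp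
    next
      case False
      then have "max 0 (1 - a) < \<alpha>\<^sub>0" using a assms(6) by auto
      then obtain \<beta> where \<beta>: "max 0 (1 - a) < \<beta>" "\<beta> < \<alpha>\<^sub>0" using dense by blast
      have "\<forall>\<^sub>F n in sequentially. P n (T \<beta> n) < a"
        using \<beta> assms(7) by (intro order_tendstoD(2)[OF lim]) auto
      then show ?thesis
        using order_tendstoD(1)[OF assms(5) \<beta>(2)] eventually_ge_at_top[of 2]
      proof eventually_elim
        case (elim n)
        have "P n (T (\<alpha> n) n) \<le> P n (T \<beta> n)"
          using elim \<beta> assms(4)[of n] by (intro anti) auto
        then show ?case using elim by simp
      qed
    qed
  qed
  have eq: "P n (T (\<alpha> n) n) = measure (M n)
            (\<Inter>x\<in>analysis_range (I n) (\<Omega> n) (\<phi> n).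
               {s \<in> space (M n).
                  x \<in> sup_ball (\<Omega> n) (Y n x s) (ev_threshold \<sigma> (\<alpha> n) (card (\<Omega> n)))})"
    if n: "n \<ge> 1" for n
  proof -
    interpret prob_space "M n" using assms(8)[OF n] .
    \<comment> \<open>On an empty index set the maximum in \<open>sup_norm_on\<close> would be
      unspecified.\<close>
    have \<Omega>_ne: "\<Omega> n \<noteq> {}" using card_\<Omega>[OF n] n by auto
    have scale: "ev_threshold \<sigma> (\<alpha> n) (card (\<Omega> n)) = \<sigma> * T (\<alpha> n) n"
      by (simp add: T_def ev_threshold_def distrib_left)
    have ball: "x \<in> sup_ball (\<Omega> n) (Y n x s) t \<longleftrightarrow> (\<forall>w\<in>\<Omega> n. \<bar>inner_on (I n) (\<phi> n w) (\<epsilon> n s)\<bar> \<le> t)"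
      if x: "x \<in> analysis_range (I n) (\<Omega> n) (\<phi> n)" for x s t
    proof -
      have "x \<in> extensional (\<Omega> n)" using x by (auto simp: analysis_range_def analysis_op_def)
      moreover have "\<bar>x w - Y n x s w\<bar> = \<bar>inner_on (I n) (\<phi> n w) (\<epsilon> n s)\<bar>" if "w \<in> \<Omega> n" for w
        using that by (simp add: assms(12) analysis_op_def I_def)
      ultimately show ?thesis
        using \<Omega>[OF n] \<Omega>_ne by (simp add: sup_ball_def sup_norm_on_def)
    qed
    \<comment> \<open>An intersection over no x would be the whole type, not the space of
      \<open>M n\<close>; the function constantly \<open>undefined\<close> is extensional and
      provides an element of the range.\<close>
    have "analysis_range (I n) (\<Omega> n) (\<phi> n) \<noteq> {}"
      by (auto simp: analysis_range_def intro!: exI[of _ "\<lambda>_. undefined"])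
    then have "(\<Inter>x\<in>analysis_range (I n) (\<Omega> n) (\<phi> n).
               {s \<in> space (M n).
                  x \<in> sup_ball (\<Omega> n) (Y n x s) (ev_threshold \<sigma> (\<alpha> n) (card (\<Omega> n)))})
        = {s\<in>space (M n). \<forall>w\<in>\<Omega> n. \<bar>inner_on (I n) (\<phi> n w) (\<epsilon> n s)\<bar> \<le> \<sigma> * T (\<alpha> n) n}"
      by (auto simp: ball scale)
    then show ?thesis
      using gauss_max_prob[OF I_ne[OF n] I \<Omega>[OF n] assms(2) assms(10)[OF n, folded I_def], of "\<phi> n" "T (\<alpha> n) n"]
        assms(11)[OF n] by (simp add: P_def I_def)
  qed
  show ?thesis
    by (rule Lim_transform_eventually[OF PT eventually_mono[OF eventually_ge_at_top[of 1] eq[unfolded I_def]]])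
qed

end
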